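(* Let $\sigma<\frac12$ and $\rho=1-2\sigma$. Then $$s_n^2(\mathbf{T}_N(\psi_\sigma))=\frac1\rho N^\rho\bigl(\lambda_n(E(\sigma,1))+o(1)\bigr),\qquad N\to\infty,$$ uniformly over $1\le n\le N$.
   Context: For real $\sigma$ and $N\in\mathbb{N}=\{1,2,\dots\}$, $\mathbf{T}_N(\psi_\sigma)$ is the $N\times N$ matrix whose $(n,m)$ entry, $1\le n,m\le N$, equals $(n/m)^{-\sigma}$ if $m$ divides $n$ and $0$ otherwise; $\{s_n(\mathbf{T}_N(\psi_\sigma))\}_{n=1}^N$ are its singular values listed in non-increasing order. $E(\sigma,1)$ is the operator on $\ell^2(\mathbb{N})$ with matrix $\left\{\frac{n^\sigma m^\sigma}{[n,m]}\right\}_{n,m=1}^\infty$, where $[n,m]$ is the least common multiple of $n$ and $m$; for $\sigma<\frac12$ it is compact and positive definite, and $\{\lambda_n(E(\sigma,1))\}_{n=1}^\infty$ are its eigenvalues listed in non-increasing order, counted with multiplicities. *)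

theory Defs
  imports
    "HOL-Analysis.Analysis"
    "HOL-Library.Function_Algebras"
    "Jordan_Normal_Form.Char_Poly"
begin

(* Rows, columns and sequences indexed by 1, 2, 3, ... are stored from position 0 on:
   position i holds the entry with index Suc i. *)

definition T_psi :: "real \<Rightarrow> nat \<Rightarrow> real mat" where
  "T_psi \<sigma> N = mat N N (\<lambda>(i, j).
     if Suc j dvd Suc i then (real (Suc i) / real (Suc j)) powr (- \<sigma>) else 0)"

(* Square roots of the eigenvalues of the Gram matrix. Its characteristic polynomial
   splits over the reals and has nonnegative roots only, so the list has full length. *)
definition singular_values :: "real mat \<Rightarrow> real list" where
  "singular_values A =
     map sqrt (rev (sorted_list_of_multiset (proots (char_poly (transpose_mat A * A)))))"

definition singular_value :: "real mat \<Rightarrow> nat \<Rightarrow> real" where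
  "singular_value A n = singular_values A ! (n - 1)"

interpretation cseq: vector_space "\<lambda>(c :: complex) (x :: nat \<Rightarrow> complex) i. c * x i"
  by unfold_locales (auto simp: fun_eq_iff algebra_simps)

definition ell2 :: "(nat \<Rightarrow> complex) set" where
  "ell2 = {x. summable (\<lambda>i. (cmod (x i))\<^sup>2)}"

definition E_entry :: "real \<Rightarrow> nat \<Rightarrow> nat \<Rightarrow> real" where
  "E_entry \<sigma> n m = real n powr \<sigma> * real m powr \<sigma> / real (lcm n m)"

definition E_op :: "real \<Rightarrow> (nat \<Rightarrow> complex) \<Rightarrow> (nat \<Rightarrow> complex)" where
  "E_op \<sigma> x = (\<lambda>i. \<Sum>j. of_real (E_entry \<sigma> (Suc i) (Suc j)) * x j)"

definition ell2_eigenspace ::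
    "((nat \<Rightarrow> complex) \<Rightarrow> (nat \<Rightarrow> complex)) \<Rightarrow> real \<Rightarrow> (nat \<Rightarrow> complex) set" where
  "ell2_eigenspace A \<mu> = {x \<in> ell2. A x = (\<lambda>i. of_real \<mu> * x i)}"

(* A non-increasing sequence in which every real number occurs as often as the dimension
   of its eigenspace says; numbers that are not eigenvalues (basis B = {}) do not occur.
   The dimension is expressed by a bijection with a basis because the library's dim
   is 0 for infinite-dimensional spaces. *)
definition lists_eigenvalues ::
    "((nat \<Rightarrow> complex) \<Rightarrow> (nat \<Rightarrow> complex)) \<Rightarrow> (nat \<Rightarrow> real) \<Rightarrow> bool" where
  "lists_eigenvalues A l \<longleftrightarrow> decseq l \<and>
     (\<forall>\<mu>. \<exists>B f. cseq.independent B \<and> cseq.span B = ell2_eigenspace A \<mu> \<and>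
            bij_betw f {k. l k = \<mu>} B)"

(* A compact positive definite operator on ell2 has exactly one such listing. *)
definition nth_eigenvalue ::
    "((nat \<Rightarrow> complex) \<Rightarrow> (nat \<Rightarrow> complex)) \<Rightarrow> nat \<Rightarrow> real" where
  "nth_eigenvalue A n = (THE l. lists_eigenvalues A l) (n - 1)"

end

theory Submission
  imports
    Defs
    "HOL-Library.Diagonal_Subsequence"
    "HOL-Number_Theory.Totient"
begin

text \<open>Write \<open>\<rho> = 1 - 2\<sigma>\<close> and \<open>L = [m,m']\<close>. Summing over the multiples \<open>k = L j \<le> N\<close> of \<open>L\<close>, the
\<open>(m,m')\<close> entry of the Gram matrix \<open>T\<^sup>T T\<close> of \<open>T = T\<^sub>N(\<psi>\<^sub>\<sigma>)\<close> is
\<open>(m m')\<^sup>\<sigma> L\<^bsup>-2\<sigma>\<^esup> \<Sum>\<^bsub>j\<le>N/L\<^esub> j\<^bsup>-2\<sigma>\<^esup>\<close>. After multiplication by \<open>\<rho> N\<^bsup>-\<rho>\<^esup>\<close> it becomes \<open>E(m,m') R\<^sub>N(L)\<close>,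
where \<open>E(m,m') = (m m')\<^sup>\<sigma> / L\<close> is the entry of \<open>E(\<sigma>,1)\<close> and
\<open>R\<^sub>N(L) = \<rho> (L/N)\<^sup>\<rho> \<Sum>\<^bsub>j\<le>N/L\<^esub> j\<^bsup>\<rho>-1\<^esup>\<close> is bounded and tends to 1 for every fixed \<open>L\<close>. The scaled
Gram matrices, extended by zeros, therefore converge to \<open>E\<close> entry by entry and are dominated by
a multiple of \<open>E\<close>.

Entrywise dominated convergence becomes convergence in operator norm because \<open>E\<close> is small far
out: for \<open>\<sigma> < \<tau> < 1/2\<close> and \<open>max m m' > K\<close> the entry of \<open>E(\<sigma>,1)\<close> is at most
\<open>K\<^bsup>\<sigma>-\<tau>\<^esup>\<close> times that of \<open>E(\<tau>,1)\<close> (\<open>E_kernel_tail_le\<close>), and \<open>E(\<tau>,1)\<close> is bounded on \<open>\<ell>\<^sup>2\<close>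
(\<open>E_kernel_bounded\<close>). Boundedness is Schur's test with weight \<open>m\<^bsup>-1/2\<^esup>\<close>; it uses that the number of
divisors of \<open>n\<close> is \<open>O(n\<^sup>\<epsilon>)\<close> for every \<open>\<epsilon> > 0\<close>. The same tail estimate gives compactness of
\<open>E(\<sigma>,1)\<close>. Weyl's inequality (\<open>weyl_inequality\<close>) turns the norm convergence of
\<open>gram_kernel_converges\<close> into convergence of the \<open>n\<close>-th eigenvalues, uniformly in \<open>n\<close>.

It remains to recognise both sides of the claim as eigenvalues in one spectral theorem, that for
compact positive operators on the real space \<open>\<ell>\<^sup>2\<close> (\<open>eigenbasis_exists\<close>). On the side of \<open>E\<close>
(\<open>nth_eigenvalue_E_op\<close>) the matrix is real and symmetric, so the complex eigenspaces are the
complexifications of the real ones; the eigenvalue 0 does not occur because \<open>E\<close> is injective,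
by Moebius inversion of \<open>gcd(n,m) = \<Sum>\<^bsub>d | n, d | m\<^esub> \<phi>(d)\<close> and a sieve. On the matrix side
(\<open>singular_value_T_psi\<close>) \<open>T\<close> is triangular with unit diagonal, so the first \<open>N\<close> eigenvalues of the
extended Gram matrix are positive, their eigenvectors live on the first \<open>N\<close> coordinates, and they
diagonalise \<open>T\<^sup>T T\<close>.\<close>

no_notation Matrix.scalar_prod (infix "\<bullet>" 70)

section \<open>Weyl comparison of eigenvalues\<close>

text \<open>The homogeneous linear system "orthogonal to \<open>k\<close> vectors" in \<open>k + 1\<close> unknown coefficients is
underdetermined. The induction is Gaussian elimination: some \<open>v p\<close> not orthogonal to \<open>u k\<close> is used
to make the other \<open>v i\<close> orthogonal to \<open>u k\<close>. All comparisons of eigenvalues rest on this dimension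
count.\<close>
lemma combination_orthogonal_to_fewer_vectors:
  fixes u v :: "nat \<Rightarrow> 'a::real_inner"
  shows "\<exists>c. (\<exists>i\<le>k. c i \<noteq> 0) \<and> (\<forall>j<k. (\<Sum>i\<le>k. c i *\<^sub>R v i) \<bullet> u j = 0)"
proof (induction k arbitrary: v)
  case 0
  show ?case by (rule exI[of _ "\<lambda>_. 1"]) auto
next
  case (Suc k)
  show ?case
  proof (cases "\<forall>i\<le>Suc k. v i \<bullet> u k = 0")
    case True
    from Suc[of v] obtain c where c: "\<exists>i\<le>k. c i \<noteq> 0" "\<And>j. j<k \<Longrightarrow> (\<Sum>i\<le>k. c i *\<^sub>R v i) \<bullet> u j = 0"
      by blast
    let ?c = "c(Suc k := 0)"
    have eq: "(\<Sum>i\<le>Suc k. ?c i *\<^sub>R v i) = (\<Sum>i\<le>k. c i *\<^sub>R v i)"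
      by (simp add: sum.atMost_Suc)
    have "(\<Sum>i\<le>k. c i *\<^sub>R v i) \<bullet> u k = 0"
      using True by (simp add: inner_sum_left)
    moreover obtain i where "i \<le> k" "c i \<noteq> 0" using c(1) by blast
    then have "i \<le> Suc k \<and> ?c i \<noteq> 0" by auto
    ultimately show ?thesis using c(2) unfolding less_Suc_eq
      by (intro exI[of _ ?c]) (metis eq)
  next
    case False
    then obtain p where p: "p \<le> Suc k" "v p \<bullet> u k \<noteq> 0" by blast
    \<comment> \<open>\<open>s\<close> enumerates the indices different from the pivot \<open>p\<close>.\<close>
    define s where "s i = (if i < p then i else Suc i)" for i
    define t where "t i = v (s i) \<bullet> u k / (v p \<bullet> u k)" for i
    define w where "w i = v (s i) - t i *\<^sub>R v p" for i
    have wk: "w i \<bullet> u k = 0" for i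
      using p by (simp add: w_def t_def inner_diff_left)
    from Suc[of w] obtain c where c: "\<exists>i\<le>k. c i \<noteq> 0" "\<And>j. j<k \<Longrightarrow> (\<Sum>i\<le>k. c i *\<^sub>R w i) \<bullet> u j = 0"
      by blast
    have inj: "inj_on s {..k}" by (auto simp: s_def inj_on_def split: if_splits)
    have img: "{..Suc k} = insert p (s ` {..k})" and pn: "p \<notin> s ` {..k}"
    proof -
      show pn: "p \<notin> s ` {..k}" by (auto simp: s_def)
      have "i \<in> s ` {..k}" if "i \<le> Suc k" "i \<noteq> p" for i
      proof (cases "i < p")
        case True then show ?thesis using p that by (intro image_eqI[of _ _ i]) (auto simp: s_def)
      next
        case False then show ?thesis using p that by (intro image_eqI[of _ _ "i-1"]) (auto simp: s_def)
      qed
      then show "{..Suc k} = insert p (s ` {..k})" using p by (auto simp: s_def)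
    qed
    define d where "d i = (if i = p then - (\<Sum>i\<le>k. c i * t i) else c (the_inv_into {..k} s i))" for i
    have ds: "d (s i) = c i" if "i \<le> k" for i
      using that pn inj by (auto simp: d_def the_inv_into_f_f)
    have "(\<Sum>i\<le>Suc k. d i *\<^sub>R v i) = d p *\<^sub>R v p + (\<Sum>i\<in>s ` {..k}. d i *\<^sub>R v i)"
      unfolding img using pn by (subst sum.insert) auto
    also have "(\<Sum>i\<in>s ` {..k}. d i *\<^sub>R v i) = (\<Sum>i\<le>k. c i *\<^sub>R v (s i))"
      by (subst sum.reindex[OF inj]) (auto simp: ds)
    also have "d p *\<^sub>R v p + \<dots> = (\<Sum>i\<le>k. c i *\<^sub>R w i)"
      by (simp add: w_def d_def sum_subtractf scaleR_diff_right scaleR_sum_left[symmetric] sum_distrib_right)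
    finally have eq: "(\<Sum>i\<le>Suc k. d i *\<^sub>R v i) = (\<Sum>i\<le>k. c i *\<^sub>R w i)" .
    from c(1) obtain i where "i \<le> k" "c i \<noteq> 0" by blast
    then have "s i \<le> Suc k \<and> d (s i) \<noteq> 0" using ds by (auto simp: s_def)
    moreover have "(\<Sum>i\<le>k. c i *\<^sub>R w i) \<bullet> u k = 0"
      by (simp add: inner_sum_left wk)
    ultimately show ?thesis using c(2) eq
      by (intro exI[of _ d]) (auto simp: less_Suc_eq)
  qed
qed

definition orthonormal_seq :: "(nat \<Rightarrow> 'a::real_inner) \<Rightarrow> bool" where
  "orthonormal_seq u \<longleftrightarrow> (\<forall>i j. u i \<bullet> u j = (if i = j then 1 else 0))"

lemma orthonormal_seqD: "orthonormal_seq u \<Longrightarrow> u i \<bullet> u j = (if i = j then 1 else 0)"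
  by (simp add: orthonormal_seq_def)

lemma orthonormal_inner_sum:
  assumes "orthonormal_seq u" "finite I"
  shows "(\<Sum>i\<in>I. c i *\<^sub>R u i) \<bullet> u j = (if j \<in> I then c j else 0)"
proof -
  have "(\<Sum>i\<in>I. c i *\<^sub>R u i) \<bullet> u j = (\<Sum>i\<in>I. if i = j then c j else 0)"
    unfolding inner_sum_left by (intro sum.cong) (auto simp: orthonormal_seqD[OF assms(1)])
  then show ?thesis using assms(2) by simp
qed

lemma orthonormal_norm_sum:
  assumes "orthonormal_seq u" "finite I"
  shows "(norm (\<Sum>i\<in>I. c i *\<^sub>R u i))\<^sup>2 = (\<Sum>i\<in>I. (c i)\<^sup>2)"
proof -
  have "(norm (\<Sum>i\<in>I. c i *\<^sub>R u i))\<^sup>2 = (\<Sum>j\<in>I. c j * ((\<Sum>i\<in>I. c i *\<^sub>R u i) \<bullet> u j))"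
    by (simp add: power2_norm_eq_inner inner_sum_right)
  also have "\<dots> = (\<Sum>j\<in>I. (c j)\<^sup>2)"
    by (intro sum.cong) (auto simp: orthonormal_inner_sum[OF assms] power2_eq_square)
  finally show ?thesis .
qed

lemma bessel_inequality:
  assumes "orthonormal_seq u" "finite I"
  shows "(\<Sum>i\<in>I. (x \<bullet> u i)\<^sup>2) \<le> (norm x)\<^sup>2"
proof -
  let ?p = "\<Sum>i\<in>I. (x \<bullet> u i) *\<^sub>R u i"
  have "0 \<le> (norm (x - ?p))\<^sup>2" by simp
  also have "\<dots> = (norm x)\<^sup>2 - 2 * (x \<bullet> ?p) + (norm ?p)\<^sup>2"
    by (simp add: power2_norm_eq_inner inner_diff_left inner_diff_right inner_commute)
  also have "x \<bullet> ?p = (\<Sum>i\<in>I. (x \<bullet> u i)\<^sup>2)"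
    by (simp add: inner_sum_right power2_eq_square)
  also have "(norm ?p)\<^sup>2 = (\<Sum>i\<in>I. (x \<bullet> u i)\<^sup>2)"
    by (rule orthonormal_norm_sum[OF assms])
  finally show ?thesis by simp
qed

text \<open>The last clause, an upper bound for the form on the orthogonal complement of the first \<open>k\<close>
eigenvectors, replaces completeness of the system: it says that no eigenvalue above \<open>l k\<close> has been
left out, and it is one half of the minimax principle.\<close>
definition eigenbasis :: "('a::real_inner \<Rightarrow> 'a) \<Rightarrow> (nat \<Rightarrow> 'a) \<Rightarrow> (nat \<Rightarrow> real) \<Rightarrow> bool" where
  "eigenbasis A u l \<longleftrightarrow> orthonormal_seq u \<and> (\<forall>k. A (u k) = l k *\<^sub>R u k) \<and> decseq l \<and>
     (\<forall>k x. (\<forall>i<k. x \<bullet> u i = 0) \<longrightarrow> A x \<bullet> x \<le> l k * (norm x)\<^sup>2)"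

text \<open>Test both forms on a nonzero vector in the span of \<open>v 0, \<dots>, v k\<close> that is orthogonal to
\<open>u 0, \<dots>, u (k - 1)\<close>: there the form of \<open>B\<close> is at least \<open>m k\<close> and that of \<open>A\<close> at most \<open>l k\<close>, per
unit of squared norm.\<close>
lemma weyl_inequality:
  assumes A: "eigenbasis A u l" and B: "eigenbasis B v m" and lin: "linear B"
    and le: "\<And>x. B x \<bullet> x \<le> A x \<bullet> x + \<delta> * (norm x)\<^sup>2"
  shows "m k \<le> l k + \<delta>"
proof -
  obtain c where c: "\<exists>i\<le>k. c i \<noteq> 0" and orth: "\<And>j. j < k \<Longrightarrow> (\<Sum>i\<le>k. c i *\<^sub>R v i) \<bullet> u j = 0"
    using combination_orthogonal_to_fewer_vectors by blast
  define x where "x = (\<Sum>i\<le>k. c i *\<^sub>R v i)"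
  have v: "orthonormal_seq v" and Bv: "\<And>i. B (v i) = m i *\<^sub>R v i" and dec: "decseq m"
    using B by (auto simp: eigenbasis_def)
  have nx: "(norm x)\<^sup>2 = (\<Sum>i\<le>k. (c i)\<^sup>2)"
    unfolding x_def by (rule orthonormal_norm_sum[OF v]) simp
  have "0 < (\<Sum>i\<le>k. (c i)\<^sup>2)" using c by (auto intro!: sum_pos2)
  then have pos: "0 < (norm x)\<^sup>2" by (simp add: nx)
  have "B x \<bullet> x = (\<Sum>i\<le>k. c i * m i * (x \<bullet> v i))"
    unfolding x_def linear_sum[OF lin] linear_scale[OF lin] Bv
    by (subst inner_sum_left) (simp add: inner_commute mult.assoc)
  also have "\<dots> = (\<Sum>i\<le>k. m i * (c i)\<^sup>2)"
    by (intro sum.cong) (auto simp: x_def orthonormal_inner_sum[OF v] power2_eq_square)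
  also have "\<dots> \<ge> (\<Sum>i\<le>k. m k * (c i)\<^sup>2)"
    by (intro sum_mono mult_right_mono) (auto intro: decseqD[OF dec])
  finally have "m k * (norm x)\<^sup>2 \<le> B x \<bullet> x" by (simp add: nx sum_distrib_left)
  also note le[of x]
  also have "A x \<bullet> x \<le> l k * (norm x)\<^sup>2"
    using A orth unfolding eigenbasis_def x_def by blast
  finally have "m k * (norm x)\<^sup>2 \<le> (l k + \<delta>) * (norm x)\<^sup>2" by (simp add: algebra_simps)
  then show ?thesis using pos by simp
qed

text \<open>The same test vector as in Weyl's inequality, now in a \<open>(k+1)\<close>-dimensional space on which the form
is positive definite.\<close>
lemma eigenvalue_positive:
  assumes A: "eigenbasis A u l"
    and pos: "\<And>c. \<exists>i\<le>k. c i \<noteq> 0 \<Longrightarrow> 0 < A (\<Sum>i\<le>k. c i *\<^sub>R v i) \<bullet> (\<Sum>i\<le>k. c i *\<^sub>R v i)"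
  shows "0 < l k"
proof -
  obtain c where c: "\<exists>i\<le>k. c i \<noteq> 0" and orth: "\<And>j. j < k \<Longrightarrow> (\<Sum>i\<le>k. c i *\<^sub>R v i) \<bullet> u j = 0"
    using combination_orthogonal_to_fewer_vectors by blast
  let ?x = "\<Sum>i\<le>k. c i *\<^sub>R v i"
  have "0 < A ?x \<bullet> ?x" by (rule pos[OF c])
  also have "\<dots> \<le> l k * (norm ?x)\<^sup>2" using A orth unfolding eigenbasis_def by blast
  finally show ?thesis by (simp add: zero_less_mult_iff)
qed

section \<open>Spectral theorem for compact positive operators\<close>

definition weak_conv :: "(nat \<Rightarrow> 'a::real_inner) \<Rightarrow> 'a \<Rightarrow> bool" where
  "weak_conv X x \<longleftrightarrow> (\<forall>y. (\<lambda>n. X n \<bullet> y) \<longlonglongrightarrow> x \<bullet> y)"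

text \<open>By Bessel's inequality the coefficients of a fixed vector are square summable, so they tend to 0.\<close>
lemma orthonormal_weak_conv:
  assumes "orthonormal_seq u"
  shows "weak_conv u 0"
  unfolding weak_conv_def
proof
  fix y
  have "summable (\<lambda>i. (y \<bullet> u i)\<^sup>2)"
    by (rule summableI_nonneg_bounded[where x = "(norm y)\<^sup>2"]) (auto intro: bessel_inequality[OF assms])
  then have "(\<lambda>i. (y \<bullet> u i)\<^sup>2) \<longlonglongrightarrow> 0" by (rule summable_LIMSEQ_zero)
  then have "(\<lambda>i. sqrt ((y \<bullet> u i)\<^sup>2)) \<longlonglongrightarrow> sqrt 0" by (rule tendsto_real_sqrt)
  then have "(\<lambda>i. \<bar>y \<bullet> u i\<bar>) \<longlonglongrightarrow> 0" by simp
  then show "(\<lambda>i. u i \<bullet> y) \<longlonglongrightarrow> 0 \<bullet> y"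
    by (simp add: tendsto_rabs_zero_iff inner_commute)
qed

text \<open>For positive operators, weak sequential continuity of the quadratic form on the unit ball amounts to
compactness, and it is the form in which compactness is used: suprema of the quadratic form are
attained. Weak sequential compactness of the unit ball and the existence of an infinite orthonormal
sequence are properties of the space; the first one takes the place of completeness.\<close>
locale compact_psd =
  fixes A :: "'a::real_inner \<Rightarrow> 'a"
  assumes linear: "linear A"
    and infinite_dimensional: "\<exists>e :: nat \<Rightarrow> 'a. orthonormal_seq e"
    and selfadjoint: "A x \<bullet> y = x \<bullet> A y"
    and psd: "0 \<le> A x \<bullet> x"
    and form_weakly_continuous:
      "(\<And>n. norm (X n) \<le> 1) \<Longrightarrow> weak_conv X x \<Longrightarrow> (\<lambda>n. A (X n) \<bullet> X n) \<longlonglongrightarrow> A x \<bullet> x"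
    and unit_ball_weakly_compact:
      "(\<And>n. norm ((Y :: nat \<Rightarrow> 'a) n) \<le> 1) \<Longrightarrow> \<exists>r x. strict_mono r \<and> norm x \<le> 1 \<and> weak_conv (Y \<circ> r) x"
begin

text \<open>A maximising sequence in the unit ball of the closed subspace \<open>W\<close> has a weakly convergent
subsequence, and the form is weakly continuous. The weak limit may have norm less than 1, but if the
maximum is positive then homogeneity forces norm 1, and if it is 0 then every unit vector of \<open>W\<close> is
a maximiser.\<close>
lemma form_maximizer_exists:
  fixes S :: "'a set"
  defines "W \<equiv> {x. \<forall>y\<in>S. x \<bullet> y = 0}"
  assumes W: "z \<in> W" "z \<noteq> 0"
  shows "\<exists>x\<in>W. norm x = 1 \<and> (\<forall>y\<in>W. A y \<bullet> y \<le> (A x \<bullet> x) * (norm y)\<^sup>2)"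
proof -
  let ?q = "\<lambda>x. A x \<bullet> x"
  have scale: "?q (c *\<^sub>R x) = c\<^sup>2 * ?q x" for c x
    by (simp add: linear_scale[OF linear] power2_eq_square)
  have Wscale: "c *\<^sub>R x \<in> W" if "x \<in> W" for c x using that by (simp add: W_def)
  have Wlim: "x \<in> W" if "\<And>n. X n \<in> W" "weak_conv X x" for X x
    unfolding W_def
  proof (safe)
    fix y assume "y \<in> S"
    then have "(\<lambda>n. X n \<bullet> y) = (\<lambda>n. 0)" using that(1) by (auto simp: W_def)
    moreover have "(\<lambda>n. X n \<bullet> y) \<longlonglongrightarrow> x \<bullet> y" using that(2) by (simp add: weak_conv_def)
    ultimately show "x \<bullet> y = 0" by (simp add: LIMSEQ_const_iff)
  qed
  define Q where "Q = ?q ` {x \<in> W. norm x \<le> 1}"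
  have Q0: "0 \<in> Q" unfolding Q_def using Wscale[OF W(1), of 0]
    by (intro image_eqI[of _ _ 0]) (auto)
  have bdd: "bdd_above Q"
  proof (rule ccontr)
    assume "\<not> bdd_above Q"
    then have "\<forall>n::nat. \<exists>x. norm x \<le> 1 \<and> ?q x > real n"
      unfolding bdd_above_def Q_def by (auto simp: not_le)
    then obtain X where X: "\<And>n. norm (X n) \<le> 1" "\<And>n. ?q (X n) > real n" by metis
    obtain r x where r: "strict_mono r" "weak_conv (X \<circ> r) x"
      using unit_ball_weakly_compact[of X] X(1) by blast
    have "(\<lambda>n. ?q ((X \<circ> r) n)) \<longlonglongrightarrow> ?q x"
      by (rule form_weakly_continuous[OF _ r(2)]) (simp add: X(1))
    then have "Bseq (\<lambda>n. ?q ((X \<circ> r) n))" by (rule convergent_imp_Bseq[OF convergentI])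
    then obtain K where K: "\<And>n. norm (?q ((X \<circ> r) n)) \<le> K" by (auto simp: Bseq_def)
    obtain n where n: "K < real n" using reals_Archimedean2 by blast
    have "real n \<le> real (r n)" using seq_suble[OF r(1)] by simp
    then show False using K[of n] X(2)[of "r n"] n by simp
  qed
  define M where "M = Sup Q"
  have le_M: "?q x \<le> M" if "x \<in> W" "norm x \<le> 1" for x
    unfolding M_def by (rule cSup_upper[OF _ bdd]) (use that in \<open>auto simp: Q_def\<close>)
  have le_M': "?q y \<le> M * (norm y)\<^sup>2" if "y \<in> W" for y
  proof (cases "y = 0")
    case False
    then have "?q ((1 / norm y) *\<^sub>R y) \<le> M" using Wscale[OF that] by (intro le_M) auto
    then have "(1 / norm y)\<^sup>2 * ?q y \<le> M" unfolding scale .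
    then show ?thesis using False by (simp add: field_simps)
  qed (simp add: linear_0[OF linear])
  have "\<forall>n::nat. \<exists>x. x \<in> W \<and> norm x \<le> 1 \<and> ?q x > M - 1 / Suc n"
  proof
    fix n :: nat
    have "M - 1 / Suc n < Sup Q" by (simp add: M_def)
    then obtain s where "s \<in> Q" "M - 1 / Suc n < s"
      using less_cSup_iff[OF _ bdd] Q0 by blast
    then show "\<exists>x. x \<in> W \<and> norm x \<le> 1 \<and> ?q x > M - 1 / Suc n" by (auto simp: Q_def)
  qed
  then obtain X where X: "\<And>n. X n \<in> W" "\<And>n. norm (X n) \<le> 1" "\<And>n::nat. ?q (X n) > M - 1 / Suc n"
    by metis
  obtain r x where r: "strict_mono r" "weak_conv (X \<circ> r) x" "norm x \<le> 1"
    using unit_ball_weakly_compact[of X] X(2) by blast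
  have xW: "x \<in> W" by (rule Wlim[OF _ r(2)]) (simp add: X(1))
  have "(\<lambda>n. ?q ((X \<circ> r) n)) \<longlonglongrightarrow> ?q x"
    by (rule form_weakly_continuous[OF _ r(2)]) (simp add: X(2))
  moreover have "(\<lambda>n. M - 1 / real (Suc n)) \<longlonglongrightarrow> M - 0"
    by (intro tendsto_diff tendsto_const LIMSEQ_Suc[OF lim_1_over_n])
  then have "(\<lambda>n. M - 1 / real (Suc (r n))) \<longlonglongrightarrow> M"
    using LIMSEQ_subseq_LIMSEQ[OF _ r(1)] by (force simp: o_def)
  ultimately have "M \<le> ?q x"
    using X(3) by (intro LIMSEQ_le[of "\<lambda>n. M - 1 / real (Suc (r n))" M "\<lambda>n. ?q ((X \<circ> r) n)"])
      (auto intro!: less_imp_le exI[of _ 0])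
  then have qx: "?q x = M" using le_M[OF xW r(3)] by simp
  show ?thesis
  proof (cases "M = 0")
    case True
    have "?q y = 0" if "y \<in> W" for y using le_M'[OF that] psd[of y] True by simp
    moreover have "(1 / norm z) *\<^sub>R z \<in> W" "norm ((1 / norm z) *\<^sub>R z) = 1"
      using W Wscale by auto
    ultimately show ?thesis by (metis mult_zero_left order_refl)
  next
    case False
    then have M: "0 < M" using qx psd[of x] by simp
    then have "1 \<le> (norm x)\<^sup>2" using le_M'[OF xW] unfolding qx by simp
    then have "1 \<le> norm x" by (simp add: power2_nonneg_ge_1_iff)
    then have "norm x = 1" using r(3) by simp
    then show ?thesis using xW le_M' qx by auto
  qed
qed

text \<open>Greedy choice: \<open>u k\<close> maximises the form among the unit vectors orthogonal to its predecessors. The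
first variation of the form at the maximiser shows that it is an eigenvector.\<close>
theorem eigenbasis_exists: "\<exists>u l. eigenbasis A u l"
proof -
  let ?q = "\<lambda>x. A x \<bullet> x"
  define W where "W f k = {x. \<forall>y\<in>f ` {..<k::nat}. x \<bullet> y = 0}" for f :: "nat \<Rightarrow> 'a" and k
  define P where "P f k r \<longleftrightarrow> r \<in> W f k \<and> norm r = 1 \<and> (\<forall>y\<in>W f k. ?q y \<le> ?q r * (norm y)\<^sup>2)" for f k r
  have "\<exists>u. \<forall>k. P u k (u k)"
  proof (rule dependent_wf_choice[OF wf_less_than, where P = P])
    fix f g :: "nat \<Rightarrow> 'a" and k r
    assume "\<And>z. (z, k) \<in> less_than \<Longrightarrow> f z = g z"
    then have "f ` {..<k} = g ` {..<k}" by (intro image_cong) auto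
    then show "P f k r = P g k r" by (simp add: P_def W_def)
  next
    fix k and f :: "nat \<Rightarrow> 'a"
    obtain e :: "nat \<Rightarrow> 'a" where e: "orthonormal_seq e" using infinite_dimensional by blast
    obtain c where c: "\<exists>i\<le>k. c i \<noteq> 0" "\<And>j. j < k \<Longrightarrow> (\<Sum>i\<le>k. c i *\<^sub>R e i) \<bullet> f j = 0"
      using combination_orthogonal_to_fewer_vectors by blast
    have "0 < (\<Sum>i\<le>k. (c i)\<^sup>2)" using c(1) by (auto intro!: sum_pos2)
    then have "(\<Sum>i\<le>k. c i *\<^sub>R e i) \<noteq> 0"
      using orthonormal_norm_sum[OF e, of "{..k}" c] by fastforce
    moreover have "(\<Sum>i\<le>k. c i *\<^sub>R e i) \<in> W f k" using c(2) by (auto simp: W_def)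
    ultimately show "\<exists>r. P f k r"
      using form_maximizer_exists[of "\<Sum>i\<le>k. c i *\<^sub>R e i" "f ` {..<k}"]
      unfolding P_def W_def Bex_def by simp
  qed
  then obtain u where u: "\<And>k. P u k (u k)" by blast
  define l where "l k = ?q (u k)" for k
  have orth: "u k \<bullet> u i = 0" if "i < k" for i k
    using u[of k] that by (auto simp: P_def W_def)
  have norm_u: "norm (u k) = 1" for k using u[of k] by (simp add: P_def)
  have maxi: "?q y \<le> l k * (norm y)\<^sup>2" if "\<forall>i<k. y \<bullet> u i = 0" for k y
    using u[of k] that by (auto simp: P_def W_def l_def)
  have on: "orthonormal_seq u"
    unfolding orthonormal_seq_def
  proof (intro allI)
    fix i j
    show "u i \<bullet> u j = (if i = j then 1 else 0)"
      using orth[of i j] orth[of j i] norm_u[of i]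
      by (cases i j rule: linorder_cases) (auto simp: inner_commute norm_eq_1)
  qed
  have eig: "A (u k) = l k *\<^sub>R u k" for k
  proof (induction k rule: less_induct)
    case (less k)
    have first_variation: "A (u k) \<bullet> y = l k * (u k \<bullet> y)" if y: "\<forall>i<k. y \<bullet> u i = 0" for y
    proof -
      define c where "c = l k * (u k \<bullet> y) - A (u k) \<bullet> y"
      define d where "d = l k * (norm y)\<^sup>2 - ?q y"
      have d: "0 \<le> d" using maxi[OF y] by (simp add: d_def)
      have "0 \<le> 2 * t * c + t\<^sup>2 * d" for t
      proof -
        let ?z = "u k + t *\<^sub>R y"
        have "?q ?z \<le> l k * (norm ?z)\<^sup>2"
          by (rule maxi) (use orth[of _ k] y in \<open>simp add: inner_add_left\<close>)
        moreover have "?q ?z = l k + 2 * t * (A (u k) \<bullet> y) + t\<^sup>2 * ?q y"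
          using selfadjoint[of y "u k"]
          by (simp add: linear_add[OF linear] linear_scale[OF linear] inner_add_left inner_add_right
              inner_commute l_def power2_eq_square algebra_simps)
        moreover have "(norm ?z)\<^sup>2 = 1 + 2 * t * (u k \<bullet> y) + t\<^sup>2 * (norm y)\<^sup>2"
          unfolding power2_norm_eq_inner inner_add_left inner_add_right inner_scaleR_left inner_scaleR_right
          using norm_u[of k] by (simp add: norm_eq_1 inner_commute power2_eq_square algebra_simps)
        ultimately show ?thesis by (simp add: c_def d_def algebra_simps)
      qed
      \<comment> \<open>The quadratic minimum would be at \<open>- c / d\<close>; the denominator \<open>d + 1\<close> covers the case \<open>d = 0\<close> as well.\<close>
      from this[of "- c / (d + 1)"] have "0 \<le> 2 * (- c / (d + 1)) * c + (- c / (d + 1))\<^sup>2 * d" .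
      also have "\<dots> = - (c\<^sup>2 * (d + 2)) / (d + 1)\<^sup>2"
      proof -
        have "d + 1 \<noteq> 0" using d by simp
        then show ?thesis by (simp add: divide_simps) (simp add: power2_eq_square algebra_simps)
      qed
      finally have "0 \<le> - (c\<^sup>2 * (d + 2)) / (d + 1)\<^sup>2" .
      then have "c\<^sup>2 * (d + 2) \<le> 0" using d by (simp add: field_simps)
      then have "c = 0" using d by (simp add: mult_le_0_iff)
      then show ?thesis by (simp add: c_def)
    qed
    define y where "y = A (u k) - l k *\<^sub>R u k"
    have "\<forall>i<k. y \<bullet> u i = 0"
      using less orth by (simp add: y_def inner_diff_left selfadjoint)
    from first_variation[OF this] have "y \<bullet> y = 0"
      by (simp add: y_def inner_diff_left)
    then show ?case by (simp add: y_def)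
  qed
  have "decseq l"
    unfolding decseq_Suc_iff
  proof
    fix k
    have "?q (u (Suc k)) \<le> l k * (norm (u (Suc k)))\<^sup>2" by (rule maxi) (use orth in auto)
    then show "l (Suc k) \<le> l k" by (simp add: l_def norm_u)
  qed
  then show ?thesis using on eig maxi unfolding eigenbasis_def by blast
qed

context
  fixes u l
  assumes basis: "eigenbasis A u l"
begin

lemma orthonormal: "orthonormal_seq u"
  and eigenvector: "A (u k) = l k *\<^sub>R u k"
  and decseq: "decseq l"
  and form_le: "\<forall>i<k. x \<bullet> u i = 0 \<Longrightarrow> A x \<bullet> x \<le> l k * (norm x)\<^sup>2"
  using basis by (auto simp: eigenbasis_def)

lemma eigenvalue_eq_form: "l k = A (u k) \<bullet> u k"
  by (simp add: eigenvector orthonormal_seqD[OF orthonormal])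

text \<open>The eigenvectors tend weakly to 0, and \<open>l k\<close> is the value of the form at \<open>u k\<close>.\<close>
lemma eigenvalues_tendsto_0: "l \<longlonglongrightarrow> 0"
proof -
  have "norm (u n) \<le> 1" for n
    by (simp add: norm_eq_sqrt_inner orthonormal_seqD[OF orthonormal])
  then have "(\<lambda>k. A (u k) \<bullet> u k) \<longlonglongrightarrow> A 0 \<bullet> 0"
    by (rule form_weakly_continuous) (rule orthonormal_weak_conv[OF orthonormal])
  then show ?thesis by (simp add: eigenvalue_eq_form[symmetric])
qed

lemma finite_multiplicity:
  assumes "\<mu> \<noteq> 0"
  shows "finite {k. l k = \<mu>}"
proof -
  have "eventually (\<lambda>k. \<bar>l k\<bar> < \<bar>\<mu>\<bar>) sequentially"
    using tendsto_rabs[OF eigenvalues_tendsto_0] assms by (intro order_tendstoD) auto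
  then obtain K where "\<And>k. K \<le> k \<Longrightarrow> \<bar>l k\<bar> < \<bar>\<mu>\<bar>" by (auto simp: eventually_sequentially)
  then have "{k. l k = \<mu>} \<subseteq> {..<K}" by (force simp: not_less[symmetric])
  then show ?thesis by (rule finite_subset) simp
qed

text \<open>The part of \<open>x\<close> not captured by the sum is orthogonal to all \<open>u k\<close>, since eigenvectors to different
eigenvalues are orthogonal. On such vectors the form is at most \<open>l k\<close> for every \<open>k\<close>, hence 0, while
on an eigenvector to \<open>\<mu> \<noteq> 0\<close> it vanishes only at 0.\<close>
lemma eigenvector_expansion:
  assumes \<mu>: "\<mu> \<noteq> 0" and x: "A x = \<mu> *\<^sub>R x"
  shows "x = (\<Sum>k | l k = \<mu>. (x \<bullet> u k) *\<^sub>R u k)"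
proof -
  define y where "y = x - (\<Sum>k | l k = \<mu>. (x \<bullet> u k) *\<^sub>R u k)"
  note fin = finite_multiplicity[OF \<mu>]
  have orth: "y \<bullet> u k = 0" for k
  proof (cases "l k = \<mu>")
    case False
    have "\<mu> * (x \<bullet> u k) = l k * (x \<bullet> u k)"
      using selfadjoint[of x "u k"] by (simp add: x eigenvector)
    then have "x \<bullet> u k = 0" using False by simp
    then show ?thesis using False by (simp add: y_def inner_diff_left orthonormal_inner_sum[OF orthonormal fin])
  qed (simp add: y_def inner_diff_left orthonormal_inner_sum[OF orthonormal fin])
  have "A (\<Sum>k | l k = \<mu>. (x \<bullet> u k) *\<^sub>R u k) = \<mu> *\<^sub>R (\<Sum>k | l k = \<mu>. (x \<bullet> u k) *\<^sub>R u k)"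
    unfolding linear_sum[OF linear] linear_scale[OF linear] scaleR_sum_right
    by (intro sum.cong) (auto simp: eigenvector)
  then have Ay: "A y = \<mu> *\<^sub>R y"
    by (simp add: y_def linear_diff[OF linear] x scaleR_diff_right)
  have "A y \<bullet> y \<le> 0 * (norm y)\<^sup>2"
    by (rule LIMSEQ_le_const[OF tendsto_mult[OF eigenvalues_tendsto_0 tendsto_const]])
      (use form_le orth in blast)
  then have "A y \<bullet> y = 0" using psd[of y] by simp
  then have "y = 0" using \<mu> by (simp add: Ay)
  then show ?thesis by (simp add: y_def)
qed

end

end

section \<open>The real Hilbert space of square-summable sequences\<close>

text \<open>A type rather than a set of sequences, so that the theory of inner product spaces applies.\<close>
typedef l2 = "{x :: nat \<Rightarrow> real. summable (\<lambda>i. (x i)\<^sup>2)}"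
  morphisms coord Abs_l2
  by (rule exI[of _ "\<lambda>_. 0"]) simp

setup_lifting type_definition_l2

lemma summable_mult_l2:
  fixes x y :: "nat \<Rightarrow> real"
  assumes "summable (\<lambda>i. (x i)\<^sup>2)" "summable (\<lambda>i. (y i)\<^sup>2)"
  shows "summable (\<lambda>i. \<bar>x i * y i\<bar>)" "summable (\<lambda>i. x i * y i)"
proof -
  have "norm \<bar>x i * y i\<bar> \<le> (x i)\<^sup>2 + (y i)\<^sup>2" for i
  proof -
    have "0 \<le> \<bar>x i\<bar> * \<bar>y i\<bar>" by simp
    moreover have "2 * \<bar>x i\<bar> * \<bar>y i\<bar> \<le> (x i)\<^sup>2 + (y i)\<^sup>2"
      using sum_squares_bound[of "\<bar>x i\<bar>" "\<bar>y i\<bar>"] by simp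
    moreover have "norm \<bar>x i * y i\<bar> = \<bar>x i\<bar> * \<bar>y i\<bar>" by (simp add: abs_mult)
    ultimately show ?thesis by linarith
  qed
  then show "summable (\<lambda>i. \<bar>x i * y i\<bar>)"
    using assms by (intro summable_comparison_test'[OF summable_add[OF assms], where N = 0]) auto
  then show "summable (\<lambda>i. x i * y i)" by (rule summable_rabs_cancel)
qed

lemma summable_add_l2:
  fixes x y :: "nat \<Rightarrow> real"
  assumes "summable (\<lambda>i. (x i)\<^sup>2)" "summable (\<lambda>i. (y i)\<^sup>2)"
  shows "summable (\<lambda>i. (x i + y i)\<^sup>2)"
  using summable_add[OF summable_add[OF assms] summable_mult[OF summable_mult_l2(2)[OF assms], of 2]]
  by (simp add: power2_sum algebra_simps)

instantiation l2 :: real_inner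
begin

lift_definition zero_l2 :: l2 is "\<lambda>_. 0" by simp
lift_definition plus_l2 :: "l2 \<Rightarrow> l2 \<Rightarrow> l2" is "\<lambda>x y i. x i + y i" by (rule summable_add_l2)
lift_definition uminus_l2 :: "l2 \<Rightarrow> l2" is "\<lambda>x i. - x i" by simp
lift_definition scaleR_l2 :: "real \<Rightarrow> l2 \<Rightarrow> l2" is "\<lambda>c x i. c * x i"
  by (simp add: power_mult_distrib summable_mult)
definition minus_l2 :: "l2 \<Rightarrow> l2 \<Rightarrow> l2" where "minus_l2 x y = x + - y"
lift_definition inner_l2 :: "l2 \<Rightarrow> l2 \<Rightarrow> real" is "\<lambda>x y. \<Sum>i. x i * y i" .
definition norm_l2 :: "l2 \<Rightarrow> real" where "norm_l2 x = sqrt (x \<bullet> x)"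
definition sgn_l2 :: "l2 \<Rightarrow> l2" where "sgn_l2 x = inverse (norm x) *\<^sub>R x"
definition dist_l2 :: "l2 \<Rightarrow> l2 \<Rightarrow> real" where "dist_l2 x y = norm (x - y)"
definition uniformity_l2 :: "(l2 \<times> l2) filter" where
  "uniformity_l2 = (INF e\<in>{0<..}. principal {(x, y). dist x y < e})"
definition open_l2 :: "l2 set \<Rightarrow> bool" where
  "open_l2 U \<longleftrightarrow> (\<forall>x\<in>U. \<forall>\<^sub>F (x', y) in uniformity. x' = x \<longrightarrow> y \<in> U)"

instance
proof
  fix x y z :: l2 and a b c :: real
  show "x + y + z = x + (y + z)" by transfer (simp add: algebra_simps)
  show "x + y = y + x" by transfer (simp add: algebra_simps)
  show "0 + x = x" by transfer simp
  show "- x + x = 0" by transfer simp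
  show "x - y = x + - y" by (rule minus_l2_def)
  show "a *\<^sub>R (x + y) = a *\<^sub>R x + a *\<^sub>R y" by transfer (simp add: algebra_simps)
  show "(a + b) *\<^sub>R x = a *\<^sub>R x + b *\<^sub>R x" by transfer (simp add: algebra_simps)
  show "a *\<^sub>R b *\<^sub>R x = (a * b) *\<^sub>R x" by transfer (simp add: algebra_simps)
  show "1 *\<^sub>R x = x" by transfer simp
  show "dist x y = norm (x - y)" by (rule dist_l2_def)
  show "sgn x = inverse (norm x) *\<^sub>R x" by (rule sgn_l2_def)
  show "uniformity = (INF e\<in>{0<..}. principal {(x :: l2, y). dist x y < e})"
    by (rule uniformity_l2_def)
  show "open U \<longleftrightarrow> (\<forall>x\<in>U. \<forall>\<^sub>F (x', y) in uniformity. x' = x \<longrightarrow> y \<in> U)" for U :: "l2 set"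
    by (rule open_l2_def)
  show "x \<bullet> y = y \<bullet> x" by transfer (simp add: mult.commute)
  show "(x + y) \<bullet> z = x \<bullet> z + y \<bullet> z"
  proof transfer
    fix x y z :: "nat \<Rightarrow> real"
    assume "summable (\<lambda>i. (x i)\<^sup>2)" "summable (\<lambda>i. (y i)\<^sup>2)" "summable (\<lambda>i. (z i)\<^sup>2)"
    then show "(\<Sum>i. (x i + y i) * z i) = (\<Sum>i. x i * z i) + (\<Sum>i. y i * z i)"
      by (simp add: suminf_add summable_mult_l2 algebra_simps)
  qed
  show "(a *\<^sub>R x) \<bullet> y = a * (x \<bullet> y)"
  proof transfer
    fix a and x y :: "nat \<Rightarrow> real"
    assume "summable (\<lambda>i. (x i)\<^sup>2)" "summable (\<lambda>i. (y i)\<^sup>2)"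
    then show "(\<Sum>i. a * x i * y i) = a * (\<Sum>i. x i * y i)"
      by (simp add: suminf_mult summable_mult_l2 mult.assoc)
  qed
  show "0 \<le> x \<bullet> x" by transfer (auto intro!: suminf_nonneg simp: power2_eq_square)
  have s: "summable (\<lambda>i. coord x i * coord x i)" using coord[of x] by (simp add: power2_eq_square)
  have "(x \<bullet> x = 0) \<longleftrightarrow> (\<forall>i. coord x i * coord x i = 0)"
    unfolding inner_l2.rep_eq by (rule suminf_eq_zero_iff[OF s]) simp
  also have "\<dots> \<longleftrightarrow> coord x = coord 0" unfolding zero_l2.rep_eq by (simp add: fun_eq_iff)
  also have "\<dots> \<longleftrightarrow> x = 0" by (rule coord_inject)
  finally show "(x \<bullet> x = 0) = (x = 0)" .
  show "norm x = sqrt (x \<bullet> x)" by (rule norm_l2_def)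
qed

end

lemma coord_simps [simp]:
  "coord 0 i = 0" "coord (x + y) i = coord x i + coord y i" "coord (- x) i = - coord x i"
  "coord (x - y) i = coord x i - coord y i" "coord (c *\<^sub>R x) i = c * coord x i"
  unfolding minus_l2_def by (simp_all add: zero_l2.rep_eq plus_l2.rep_eq uminus_l2.rep_eq scaleR_l2.rep_eq del: add_uminus_conv_diff)

lemma coord_sum [simp]: "coord (sum f I) i = (\<Sum>k\<in>I. coord (f k) i)"
  by (induction I rule: infinite_finite_induct) auto

lemma l2_eqI: "(\<And>i. coord x i = coord y i) \<Longrightarrow> x = y"
  by (metis coord_inject ext)

lemma summable_coord: "summable (\<lambda>i. (coord x i)\<^sup>2)"
  using coord[of x] by simp

lemma coord_Abs: "summable (\<lambda>i. (f i)\<^sup>2) \<Longrightarrow> coord (Abs_l2 f) = f"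
  by (rule Abs_l2_inverse) simp

lemma summable_coord_mult: "summable (\<lambda>i. coord x i * coord y i)"
  by (rule summable_mult_l2 summable_coord)+

lemma inner_l2_sums: "(\<lambda>i. coord x i * coord y i) sums (x \<bullet> y)"
  unfolding inner_l2.rep_eq by (rule summable_sums[OF summable_coord_mult])

lemma inner_l2_LIMSEQ: "(\<lambda>n. \<Sum>i<n. coord x i * coord y i) \<longlonglongrightarrow> x \<bullet> y"
  using inner_l2_sums by (simp add: sums_def)

lemma norm_l2_sums: "(\<lambda>i. (coord x i)\<^sup>2) sums (norm x)\<^sup>2"
  using inner_l2_sums[of x x] unfolding power2_norm_eq_inner by (simp only: power2_eq_square)

lemma L2_set_coord_le: "L2_set (coord x) {..<n} \<le> norm x"
proof -
  have "(\<Sum>i<n. (coord x i)\<^sup>2) \<le> (norm x)\<^sup>2"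
    using sum_le_suminf[OF summable_coord[of x], of "{..<n}"] norm_l2_sums[of x] by (simp add: sums_iff)
  then have "sqrt (\<Sum>i<n. (coord x i)\<^sup>2) \<le> sqrt ((norm x)\<^sup>2)" by (rule real_sqrt_le_mono)
  then show ?thesis by (simp add: L2_set_def)
qed

lemma abs_coord_le: "\<bar>coord x i\<bar> \<le> norm x"
proof -
  have "\<bar>coord x i\<bar> \<le> L2_set (\<lambda>i. \<bar>coord x i\<bar>) {..<Suc i}" by (rule member_le_L2_set) auto
  also have "\<dots> = L2_set (coord x) {..<Suc i}" by (simp add: L2_set_def)
  also have "\<dots> \<le> norm x" by (rule L2_set_coord_le)
  finally show ?thesis .
qed

text \<open>A bound on the finite sections that does not depend on their length is how sequences are shown to
lie in \<open>l2\<close>.\<close>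
lemma bounded_partial_sums_l2:
  assumes "\<And>n. L2_set f {..<n} \<le> B"
  shows "summable (\<lambda>i. (f i)\<^sup>2)" "norm (Abs_l2 f) \<le> B"
proof -
  have B: "0 \<le> B" using assms[of 0] by simp
  have le: "(\<Sum>i<n. (f i)\<^sup>2) \<le> B\<^sup>2" for n
  proof -
    have "(L2_set f {..<n})\<^sup>2 \<le> B\<^sup>2" by (rule power_mono[OF assms]) simp
    then show ?thesis by (simp add: L2_set_def sum_nonneg)
  qed
  then show s: "summable (\<lambda>i. (f i)\<^sup>2)" by (intro summableI_nonneg_bounded) auto
  have "(\<Sum>i. (f i)\<^sup>2) \<le> B\<^sup>2" by (rule suminf_le_const[OF s le])
  then have "(norm (Abs_l2 f))\<^sup>2 \<le> B\<^sup>2"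
    using norm_l2_sums[of "Abs_l2 f"] by (simp add: coord_Abs[OF s] sums_iff)
  then show "norm (Abs_l2 f) \<le> B" using B by (rule power2_le_imp_le)
qed

lift_definition unit_l2 :: "nat \<Rightarrow> l2" is "\<lambda>k i. if i = k then 1 else 0"
proof -
  fix k :: nat
  show "summable (\<lambda>i. (if i = k then 1 else 0 :: real)\<^sup>2)"
    by (rule summable_finite[of "{k}"]) auto
qed

lemma coord_unit [simp]: "coord (unit_l2 k) i = (if i = k then 1 else 0)"
  by transfer simp

lemma inner_unit_l2 [simp]: "x \<bullet> unit_l2 k = coord x k"
proof -
  have "(\<lambda>i. coord x i * coord (unit_l2 k) i) sums (\<Sum>i\<in>{k}. coord x i * coord (unit_l2 k) i)"
    by (rule sums_finite) auto
  from sums_unique2[OF inner_l2_sums this] show ?thesis by simp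
qed

lemma orthonormal_unit_l2: "orthonormal_seq unit_l2"
  by (auto simp: orthonormal_seq_def)

definition trunc :: "nat \<Rightarrow> l2 \<Rightarrow> l2" where
  "trunc K x = (\<Sum>k<K. coord x k *\<^sub>R unit_l2 k)"

lemma coord_trunc [simp]: "coord (trunc K x) i = (if i < K then coord x i else 0)"
proof -
  have "coord (trunc K x) i = (\<Sum>k<K. if i = k then coord x k else 0)"
    unfolding trunc_def coord_sum by (intro sum.cong) auto
  then show ?thesis by simp
qed

lemma trunc_inner: "trunc K x \<bullet> y = (\<Sum>k<K. coord x k * coord y k)"
  by (simp add: trunc_def inner_sum_left inner_commute[of "unit_l2 _"])

lemma trunc_tendsto: "(\<lambda>K. trunc K x) \<longlonglongrightarrow> x"
proof -
  have eq: "(norm (x - trunc K x))\<^sup>2 = (norm x)\<^sup>2 - (\<Sum>k<K. (coord x k)\<^sup>2)" for K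
  proof -
    have "trunc K x \<bullet> trunc K x = trunc K x \<bullet> x" by (simp add: trunc_inner)
    then have "(norm (x - trunc K x))\<^sup>2 = (norm x)\<^sup>2 - trunc K x \<bullet> x"
      by (simp add: power2_norm_eq_inner inner_diff_left inner_diff_right inner_commute)
    then show ?thesis by (simp add: trunc_inner power2_eq_square)
  qed
  have "(\<lambda>K. (norm x)\<^sup>2 - (\<Sum>k<K. (coord x k)\<^sup>2)) \<longlonglongrightarrow> (norm x)\<^sup>2 - (norm x)\<^sup>2"
    using norm_l2_sums[of x] by (intro tendsto_diff tendsto_const) (simp add: sums_def)
  then have "(\<lambda>K. sqrt ((norm (x - trunc K x))\<^sup>2)) \<longlonglongrightarrow> sqrt 0"
    unfolding eq by (intro tendsto_real_sqrt) simp
  then have "(\<lambda>K. norm (trunc K x - x)) \<longlonglongrightarrow> 0" by (simp add: norm_minus_commute)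
  then show ?thesis by (rule LIM_zero_cancel[OF tendsto_norm_zero_cancel])
qed

lemma weak_conv_coord: "weak_conv X x \<Longrightarrow> (\<lambda>n. coord (X n) i) \<longlonglongrightarrow> coord x i"
  unfolding weak_conv_def by (drule spec[of _ "unit_l2 i"]) simp

text \<open>For bounded sequences coordinatewise convergence suffices, because the finitely supported vectors
are dense.\<close>
lemma weak_conv_l2I:
  assumes bounded: "\<And>n. norm (X n) \<le> B" and coordwise: "\<And>i. (\<lambda>n. coord (X n) i) \<longlonglongrightarrow> coord x i"
  shows "weak_conv X x"
  unfolding weak_conv_def
proof
  fix y
  have B: "0 \<le> B" using order_trans[OF norm_ge_zero bounded[of 0]] .
  show "(\<lambda>n. X n \<bullet> y) \<longlonglongrightarrow> x \<bullet> y"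
  proof (rule metric_LIMSEQ_I)
    fix r :: real assume r: "0 < r"
    define e where "e = r / (2 * (B + norm x + 1))"
    have e: "0 < e" using r B by (simp add: e_def add_nonneg_pos)
    obtain K where K: "norm (trunc K y - y) < e"
      using LIMSEQ_D[OF trunc_tendsto e] by blast
    have "(\<lambda>n. \<Sum>k<K. coord y k * coord (X n) k) \<longlonglongrightarrow> (\<Sum>k<K. coord y k * coord x k)"
      by (intro tendsto_sum tendsto_mult tendsto_const coordwise)
    then obtain n0 where n0: "\<And>n. n \<ge> n0 \<Longrightarrow> \<bar>trunc K y \<bullet> X n - trunc K y \<bullet> x\<bar> < r / 2"
      using r unfolding trunc_inner LIMSEQ_iff by (metis half_gt_zero real_norm_def)
    have "dist (X n \<bullet> y) (x \<bullet> y) < r" if "n \<ge> n0" for n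
    proof -
      have "\<bar>(y - trunc K y) \<bullet> (X n - x)\<bar> \<le> norm (y - trunc K y) * norm (X n - x)"
        by (rule Cauchy_Schwarz_ineq2)
      also have "\<dots> \<le> e * (B + norm x)"
      proof (rule mult_mono)
        show "norm (y - trunc K y) \<le> e" using K by (simp add: norm_minus_commute)
        show "norm (X n - x) \<le> B + norm x" using norm_triangle_ineq4[of "X n" x] bounded[of n] by simp
      qed (use e in auto)
      also have "\<dots> \<le> e * (B + norm x + 1)" using e by (simp add: algebra_simps)
      also have "\<dots> = r / 2"
      proof -
        have "r / (2 * d) * d = r / 2" if "d \<noteq> 0" for d :: real using that by simp
        moreover have "B + norm x + 1 \<noteq> 0" using B norm_ge_zero[of x] by linarith
        ultimately show ?thesis unfolding e_def by blast
      qed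
      finally have "\<bar>(y - trunc K y) \<bullet> (X n - x)\<bar> \<le> r / 2" .
      moreover have "X n \<bullet> y - x \<bullet> y = (y - trunc K y) \<bullet> (X n - x) + (trunc K y \<bullet> X n - trunc K y \<bullet> x)"
        by (simp add: inner_diff_left inner_diff_right inner_commute)
      ultimately show ?thesis using n0[OF that] unfolding dist_real_def by linarith
    qed
    then show "\<exists>no. \<forall>n\<ge>no. dist (X n \<bullet> y) (x \<bullet> y) < r" by blast
  qed
qed

text \<open>A diagonal subsequence converges in every coordinate; the bound on the finite sections passes to the
limit.\<close>
lemma l2_unit_ball_weakly_compact:
  fixes X :: "nat \<Rightarrow> l2"
  assumes "\<And>n. norm (X n) \<le> 1"
  shows "\<exists>r x. strict_mono r \<and> norm x \<le> 1 \<and> weak_conv (X \<circ> r) x"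
proof -
  define P where "P k s = convergent (\<lambda>n. coord (X (s n)) k)" for k and s :: "nat \<Rightarrow> nat"
  have P_iff: "P k s \<longleftrightarrow> convergent (\<lambda>n. coord (X (s n)) k)" for k s by (simp add: P_def)
  interpret subseqs P
  proof
    fix k and s :: "nat \<Rightarrow> nat"
    have "bounded (range (\<lambda>n. coord (X (s n)) k))"
      unfolding bounded_iff using order_trans[OF abs_coord_le assms] by auto
    from bounded_imp_convergent_subsequence[OF this]
    obtain l r where "strict_mono r" "((\<lambda>n. coord (X (s n)) k) \<circ> r) \<longlonglongrightarrow> l" by blast
    then show "\<exists>r'. strict_mono r' \<and> P k (s \<circ> r')"
      by (auto simp: P_def o_def convergent_def)
  qed
  have "P k (diagseq \<circ> (+) (Suc k))" for k
  proof (rule diagseq_holds)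
    fix r s :: "nat \<Rightarrow> nat" and n assume "strict_mono r" "P n s"
    then show "P n (s \<circ> r)"
      unfolding P_def convergent_def by (force dest: LIMSEQ_subseq_LIMSEQ[of _ _ r] simp: o_def)
  qed
  then have "convergent (\<lambda>n. coord (X (diagseq (n + Suc k))) k)" for k
    unfolding P_iff o_def by (simp only: add.commute)
  then have "convergent (\<lambda>n. coord (X (diagseq n)) k)" for k
    using convergent_ignore_initial_segment[of "\<lambda>n. coord (X (diagseq n)) k" "Suc k"] by simp
  then obtain f where f: "\<And>k. (\<lambda>n. coord (X (diagseq n)) k) \<longlonglongrightarrow> f k"
    unfolding convergent_def by metis
  have "L2_set f {..<m} \<le> 1" for m
  proof (rule LIMSEQ_le_const2)
    show "(\<lambda>n. L2_set (coord (X (diagseq n))) {..<m}) \<longlonglongrightarrow> L2_set f {..<m}"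
      unfolding L2_set_def by (intro tendsto_intros f)
    show "\<exists>N. \<forall>n\<ge>N. L2_set (coord (X (diagseq n))) {..<m} \<le> 1"
      using order_trans[OF L2_set_coord_le assms] by blast
  qed
  note b = bounded_partial_sums_l2[OF this]
  have "weak_conv (X \<circ> diagseq) (Abs_l2 f)"
    by (rule weak_conv_l2I[of _ 1]) (auto simp: assms coord_Abs[OF b(1)] f)
  then show ?thesis using subseq_diagseq b(2) by blast
qed

section \<open>Operators given by bounded kernels\<close>

text \<open>Boundedness of the matrix of absolute values, stated through finite sections only, so that no
convergence question arises. It is inherited by entrywise smaller matrices, which boundedness of the
operator itself is not.\<close>
definition kernel_bound :: "(nat \<Rightarrow> nat \<Rightarrow> real) \<Rightarrow> real \<Rightarrow> bool" where
  "kernel_bound a H \<longleftrightarrow> 0 \<le> H \<and>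
     (\<forall>n x y. (\<Sum>i<n. \<Sum>j<n. \<bar>a i j\<bar> * \<bar>x i\<bar> * \<bar>y j\<bar>) \<le> H * L2_set x {..<n} * L2_set y {..<n})"

lemma kernel_boundD:
  "kernel_bound a H \<Longrightarrow> (\<Sum>i<n. \<Sum>j<n. \<bar>a i j\<bar> * \<bar>x i\<bar> * \<bar>y j\<bar>) \<le> H * L2_set x {..<n} * L2_set y {..<n}"
  by (auto simp: kernel_bound_def)

lemma kernel_bound_nonneg: "kernel_bound a H \<Longrightarrow> 0 \<le> H"
  by (simp add: kernel_bound_def)

lemma kernel_bound_weaken: "kernel_bound a H \<Longrightarrow> H \<le> H' \<Longrightarrow> kernel_bound a H'"
  unfolding kernel_bound_def by (fastforce intro: order_trans mult_right_mono)

lemma kernel_bound_mono: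
  assumes "kernel_bound a H" "0 \<le> c" "\<And>i j. \<bar>b i j\<bar> \<le> c * \<bar>a i j\<bar>"
  shows "kernel_bound b (c * H)"
  unfolding kernel_bound_def
proof (intro conjI allI)
  show "0 \<le> c * H" using assms(2) kernel_bound_nonneg[OF assms(1)] by simp
  fix n and x y :: "nat \<Rightarrow> real"
  have "(\<Sum>i<n. \<Sum>j<n. \<bar>b i j\<bar> * \<bar>x i\<bar> * \<bar>y j\<bar>) \<le> (\<Sum>i<n. \<Sum>j<n. c * \<bar>a i j\<bar> * \<bar>x i\<bar> * \<bar>y j\<bar>)"
    by (intro sum_mono mult_right_mono assms(3)) auto
  also have "\<dots> = c * (\<Sum>i<n. \<Sum>j<n. \<bar>a i j\<bar> * \<bar>x i\<bar> * \<bar>y j\<bar>)"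
    by (simp add: sum_distrib_left mult.assoc)
  also have "\<dots> \<le> c * (H * L2_set x {..<n} * L2_set y {..<n})"
    by (intro mult_left_mono kernel_boundD assms)
  finally show "(\<Sum>i<n. \<Sum>j<n. \<bar>b i j\<bar> * \<bar>x i\<bar> * \<bar>y j\<bar>) \<le> c * H * L2_set x {..<n} * L2_set y {..<n}"
    by (simp add: mult.assoc)
qed

lemma kernel_bound_add:
  assumes "kernel_bound a H" "kernel_bound b K" "\<And>i j. \<bar>d i j\<bar> \<le> \<bar>a i j\<bar> + \<bar>b i j\<bar>"
  shows "kernel_bound d (H + K)"
  unfolding kernel_bound_def
proof (intro conjI allI)
  show "0 \<le> H + K" using kernel_bound_nonneg[OF assms(1)] kernel_bound_nonneg[OF assms(2)] by simp
  fix n and x y :: "nat \<Rightarrow> real"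
  have "(\<Sum>i<n. \<Sum>j<n. \<bar>d i j\<bar> * \<bar>x i\<bar> * \<bar>y j\<bar>)
      \<le> (\<Sum>i<n. \<Sum>j<n. (\<bar>a i j\<bar> + \<bar>b i j\<bar>) * \<bar>x i\<bar> * \<bar>y j\<bar>)"
    by (intro sum_mono mult_right_mono assms(3)) auto
  also have "\<dots> = (\<Sum>i<n. \<Sum>j<n. \<bar>a i j\<bar> * \<bar>x i\<bar> * \<bar>y j\<bar>) + (\<Sum>i<n. \<Sum>j<n. \<bar>b i j\<bar> * \<bar>x i\<bar> * \<bar>y j\<bar>)"
    by (simp add: sum.distrib distrib_right)
  also have "\<dots> \<le> H * L2_set x {..<n} * L2_set y {..<n} + K * L2_set x {..<n} * L2_set y {..<n}"
    by (intro add_mono kernel_boundD assms)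
  finally show "(\<Sum>i<n. \<Sum>j<n. \<bar>d i j\<bar> * \<bar>x i\<bar> * \<bar>y j\<bar>) \<le> (H + K) * L2_set x {..<n} * L2_set y {..<n}"
    by (simp add: distrib_right)
qed

lemma abs_le_L2_set: "finite A \<Longrightarrow> i \<in> A \<Longrightarrow> \<bar>f i\<bar> \<le> L2_set f A"
  using member_le_L2_set[of A i "\<lambda>i. \<bar>f i\<bar>"] by (simp add: L2_set_def)

lemma kernel_bound_finite:
  assumes "\<And>i j. i \<ge> K \<or> j \<ge> K \<Longrightarrow> a i j = 0"
  shows "kernel_bound a (\<Sum>i<K. \<Sum>j<K. \<bar>a i j\<bar>)"
  unfolding kernel_bound_def
proof (intro conjI allI)
  show "0 \<le> (\<Sum>i<K. \<Sum>j<K. \<bar>a i j\<bar>)" by (intro sum_nonneg) auto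
  fix n and x y :: "nat \<Rightarrow> real"
  let ?s = "\<lambda>n. \<Sum>i<n. \<Sum>j<n. \<bar>a i j\<bar>"
  have "?s n \<le> ?s (max n K)"
    unfolding sum.cartesian_product by (intro sum_mono2) auto
  also have "\<dots> = ?s K"
    unfolding sum.cartesian_product
    by (intro sum.mono_neutral_right) (auto, (meson assms not_le)+)
  finally have s: "?s n \<le> ?s K" .
  have "(\<Sum>i<n. \<Sum>j<n. \<bar>a i j\<bar> * \<bar>x i\<bar> * \<bar>y j\<bar>)
      \<le> (\<Sum>i<n. \<Sum>j<n. \<bar>a i j\<bar> * L2_set x {..<n} * L2_set y {..<n})"
    by (intro sum_mono mult_mono abs_le_L2_set mult_nonneg_nonneg) auto
  also have "\<dots> = ?s n * (L2_set x {..<n} * L2_set y {..<n})"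
    by (simp add: sum_distrib_right mult.assoc)
  also have "\<dots> \<le> ?s K * (L2_set x {..<n} * L2_set y {..<n})"
    by (intro mult_right_mono s) auto
  finally show "(\<Sum>i<n. \<Sum>j<n. \<bar>a i j\<bar> * \<bar>x i\<bar> * \<bar>y j\<bar>) \<le> ?s K * L2_set x {..<n} * L2_set y {..<n}"
    by (simp add: mult.assoc)
qed

text \<open>Cauchy's inequality on the index pairs, after splitting
\<open>a i j = sqrt (a i j * w j / w i) * sqrt (a j i * w i / w j)\<close>; each factor is then controlled by the
weighted row sums.\<close>
lemma schur_test:
  fixes a :: "nat \<Rightarrow> nat \<Rightarrow> real"
  assumes nonneg: "\<And>i j. 0 \<le> a i j" and sym: "\<And>i j. a i j = a j i" and w: "\<And>i. 0 < w i"
    and row: "\<And>i n. (\<Sum>j<n. a i j * w j) \<le> H * w i"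
  shows "kernel_bound a H"
  unfolding kernel_bound_def
proof (intro conjI allI)
  have "0 \<le> H * w 0" using row[of 0 0] by simp
  then show H: "0 \<le> H" using w[of 0] by (simp add: zero_le_mult_iff)
  fix n and x y :: "nat \<Rightarrow> real"
  let ?P = "{..<n} \<times> {..<n} :: (nat \<times> nat) set"
  let ?f = "\<lambda>x (i :: nat, j :: nat). sqrt (a i j * w j / w i) * \<bar>x i\<bar>"
  have f: "L2_set (?f x) ?P \<le> sqrt H * L2_set x {..<n}" for x
  proof -
    have "(\<Sum>p\<in>?P. (?f x p)\<^sup>2) = (\<Sum>i<n. \<Sum>j<n. (a i j * w j / w i) * (x i)\<^sup>2)"
      unfolding sum.cartesian_product using nonneg w
      by (intro sum.cong) (auto simp: power_mult_distrib less_imp_le)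
    also have "\<dots> = (\<Sum>i<n. (\<Sum>j<n. a i j * w j) * ((x i)\<^sup>2 / w i))"
      by (simp add: sum_distrib_right sum_divide_distrib)
    also have "\<dots> \<le> (\<Sum>i<n. (H * w i) * ((x i)\<^sup>2 / w i))"
      using w by (intro sum_mono mult_right_mono row) (auto simp: less_imp_le)
    also have "\<dots> = H * (\<Sum>i<n. (x i)\<^sup>2)"
      unfolding sum_distrib_left using w by (intro sum.cong) (auto simp: less_imp_neq[THEN not_sym])
    finally show ?thesis unfolding L2_set_def by (simp add: real_sqrt_mult[symmetric])
  qed
  have swap: "L2_set (\<lambda>(i, j). ?f y (j, i)) ?P = L2_set (?f y) ?P"
    unfolding L2_set_def
    by (intro arg_cong[of _ _ sqrt] sum.reindex_bij_witness[of _ prod.swap prod.swap]) auto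
  have "(\<Sum>i<n. \<Sum>j<n. \<bar>a i j\<bar> * \<bar>x i\<bar> * \<bar>y j\<bar>)
      = (\<Sum>p\<in>?P. \<bar>?f x p\<bar> * \<bar>(\<lambda>(i, j). ?f y (j, i)) p\<bar>)"
    unfolding sum.cartesian_product
  proof (intro sum.cong refl)
    fix p :: "nat \<times> nat"
    obtain i j where p: "p = (i, j)" by (cases p)
    have "sqrt (a i j * w j / w i) * sqrt (a i j * w i / w j) = sqrt ((a i j)\<^sup>2)"
      using w[of i] w[of j] by (simp add: real_sqrt_mult[symmetric] power2_eq_square)
    then have "sqrt (a i j * w j / w i) * sqrt (a j i * w i / w j) = \<bar>a i j\<bar>"
      using sym[of i j] by simp
    then show "(case p of (i, j) \<Rightarrow> \<bar>a i j\<bar> * \<bar>x i\<bar> * \<bar>y j\<bar>) = \<bar>?f x p\<bar> * \<bar>(\<lambda>(i, j). ?f y (j, i)) p\<bar>"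
      using nonneg[of i j] nonneg[of j i] w[of i] w[of j]
      by (simp add: p abs_mult)
  qed
  also have "\<dots> \<le> L2_set (?f x) ?P * L2_set (?f y) ?P"
    using L2_set_mult_ineq[of "?f x" "\<lambda>(i, j). ?f y (j, i)" ?P] unfolding swap .
  also have "\<dots> \<le> (sqrt H * L2_set x {..<n}) * (sqrt H * L2_set y {..<n})"
    by (intro mult_mono f) (auto simp: H)
  also have "\<dots> = (sqrt H * sqrt H) * L2_set x {..<n} * L2_set y {..<n}" by (simp only: ac_simps)
  finally show "(\<Sum>i<n. \<Sum>j<n. \<bar>a i j\<bar> * \<bar>x i\<bar> * \<bar>y j\<bar>) \<le> H * L2_set x {..<n} * L2_set y {..<n}"
    using H by simp
qed

definition kernel_row :: "(nat \<Rightarrow> nat \<Rightarrow> real) \<Rightarrow> nat \<Rightarrow> l2" where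
  "kernel_row a i = Abs_l2 (a i)"

text \<open>Coordinates are inner products with the rows, so linearity is inherited from the inner product.\<close>
definition kernel_op :: "(nat \<Rightarrow> nat \<Rightarrow> real) \<Rightarrow> l2 \<Rightarrow> l2" where
  "kernel_op a x = Abs_l2 (\<lambda>i. kernel_row a i \<bullet> x)"

context
  fixes a H
  assumes bound: "kernel_bound a H"
begin

lemma kernel_partial_form_le:
  "\<bar>\<Sum>i<n. \<Sum>j<n. a i j * x i * y j\<bar> \<le> H * L2_set x {..<n} * L2_set y {..<n}"
proof -
  have "\<bar>\<Sum>i<n. \<Sum>j<n. a i j * x i * y j\<bar> \<le> (\<Sum>i<n. \<bar>\<Sum>j<n. a i j * x i * y j\<bar>)"
    by (rule sum_abs)
  also have "\<dots> \<le> (\<Sum>i<n. \<Sum>j<n. \<bar>a i j\<bar> * \<bar>x i\<bar> * \<bar>y j\<bar>)"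
    by (intro sum_mono order_trans[OF sum_abs]) (simp add: abs_mult)
  also note kernel_boundD[OF bound]
  finally show ?thesis .
qed

text \<open>The bound applied to the \<open>i\<close>-th unit vector and to a finite section \<open>y\<close> of the row reads
\<open>\<parallel>y\<parallel>\<^sup>2 \<le> H \<parallel>y\<parallel>\<close>.\<close>
lemma row_summable: "summable (\<lambda>j. (a i j)\<^sup>2)"
proof (rule bounded_partial_sums_l2(1))
  fix n
  define m where "m = max n (Suc i)"
  define x where "x k = (if k = i then 1 else 0 :: real)" for k
  define y where "y k = (if k < n then a i k else 0)" for k
  have im: "i < m" by (simp add: m_def)
  have Ly: "(L2_set y {..<m})\<^sup>2 = (\<Sum>k<m. (y k)\<^sup>2)" by (simp add: L2_set_def sum_nonneg)
  have Ly': "L2_set y {..<m} = L2_set (a i) {..<n}"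
    unfolding L2_set_def m_def
    by (intro arg_cong[of _ _ sqrt] sum.mono_neutral_cong_right) (auto simp: y_def)
  have Lx: "L2_set x {..<m} = 1"
  proof -
    have "(\<Sum>k<m. (x k)\<^sup>2) = (\<Sum>k<m. if k = i then 1 else 0)"
      by (intro sum.cong) (auto simp: x_def)
    then show ?thesis using im by (simp add: L2_set_def)
  qed
  have "(\<Sum>k<m. \<Sum>j<m. a k j * x k * y j) = (\<Sum>k<m. if k = i then \<Sum>j<m. a i j * y j else 0)"
    by (intro sum.cong) (auto simp: x_def)
  also have "\<dots> = (\<Sum>j<m. a i j * y j)" using im by simp
  also have "\<dots> = (\<Sum>j<m. (y j)\<^sup>2)"
    by (intro sum.cong) (auto simp: y_def power2_eq_square)
  finally have "(L2_set y {..<m})\<^sup>2 \<le> H * L2_set y {..<m}"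
    using kernel_partial_form_le[where n = m and x = x and y = y] by (simp add: Lx Ly)
  then have "L2_set y {..<m} \<le> H"
    using kernel_bound_nonneg[OF bound] L2_set_nonneg[of y "{..<m}"]
    by (cases "L2_set y {..<m} = 0") (auto simp: power2_eq_square)
  then show "L2_set (a i) {..<n} \<le> H" by (simp add: Ly')
qed

lemma coord_kernel_row [simp]: "coord (kernel_row a i) = a i"
  unfolding kernel_row_def by (rule coord_Abs[OF row_summable])

lemma kernel_rows_le: "\<bar>\<Sum>i<n. y i * (kernel_row a i \<bullet> x)\<bar> \<le> H * L2_set y {..<n} * norm x"
proof (rule LIMSEQ_le_const2)
  show "(\<lambda>m. \<bar>\<Sum>i<n. y i * (\<Sum>j<m. coord (kernel_row a i) j * coord x j)\<bar>)
      \<longlonglongrightarrow> \<bar>\<Sum>i<n. y i * (kernel_row a i \<bullet> x)\<bar>"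
    by (intro tendsto_intros inner_l2_LIMSEQ)
  show "\<exists>N. \<forall>m\<ge>N. \<bar>\<Sum>i<n. y i * (\<Sum>j<m. coord (kernel_row a i) j * coord x j)\<bar>
      \<le> H * L2_set y {..<n} * norm x"
  proof (intro exI allI impI)
    fix m assume "n \<le> m"
    define z where "z i = (if i < n then y i else 0)" for i
    have L: "L2_set z {..<m} = L2_set y {..<n}"
      unfolding L2_set_def using \<open>n \<le> m\<close>
      by (intro arg_cong[of _ _ sqrt] sum.mono_neutral_cong_right) (auto simp: z_def)
    have "(\<Sum>i<n. y i * (\<Sum>j<m. coord (kernel_row a i) j * coord x j))
        = (\<Sum>i<m. z i * (\<Sum>j<m. a i j * coord x j))"
      using \<open>n \<le> m\<close> by (intro sum.mono_neutral_cong_left) (auto simp: z_def)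
    also have "\<dots> = (\<Sum>i<m. \<Sum>j<m. a i j * z i * coord x j)"
      by (simp add: sum_distrib_left algebra_simps)
    also have "\<bar>\<dots>\<bar> \<le> H * L2_set z {..<m} * L2_set (coord x) {..<m}"
      by (rule kernel_partial_form_le)
    also have "\<dots> \<le> H * L2_set y {..<n} * norm x"
      unfolding L by (intro mult_left_mono L2_set_coord_le mult_nonneg_nonneg)
        (auto simp: kernel_bound_nonneg[OF bound])
    finally show "\<bar>\<Sum>i<n. y i * (\<Sum>j<m. coord (kernel_row a i) j * coord x j)\<bar>
      \<le> H * L2_set y {..<n} * norm x" .
  qed
qed

text \<open>Pairing a finite section \<open>y\<close> of the image of \<open>x\<close> with itself gives \<open>\<parallel>y\<parallel>\<^sup>2 \<le> H \<parallel>y\<parallel> \<parallel>x\<parallel>\<close>.\<close>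
lemma kernel_op_bounded:
  shows kernel_op_summable: "summable (\<lambda>i. (kernel_row a i \<bullet> x)\<^sup>2)"
    and norm_kernel_op_le: "norm (kernel_op a x) \<le> H * norm x"
proof -
  let ?y = "\<lambda>i. kernel_row a i \<bullet> x"
  have le: "L2_set ?y {..<n} \<le> H * norm x" for n
  proof -
    have "(L2_set ?y {..<n})\<^sup>2 = (\<Sum>i<n. ?y i * ?y i)" by (simp add: L2_set_def sum_nonneg power2_eq_square)
    also have "\<dots> \<le> H * L2_set ?y {..<n} * norm x" using kernel_rows_le[of ?y x n] by linarith
    finally show ?thesis
      using kernel_bound_nonneg[OF bound] L2_set_nonneg[of ?y "{..<n}"]
      by (cases "L2_set ?y {..<n} = 0") (auto simp: power2_eq_square mult_ac)
  qed
  show "summable (\<lambda>i. (?y i)\<^sup>2)" by (rule bounded_partial_sums_l2(1)[OF le])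
  show "norm (kernel_op a x) \<le> H * norm x"
    unfolding kernel_op_def by (rule bounded_partial_sums_l2(2)[OF le])
qed

lemma coord_kernel_op: "coord (kernel_op a x) i = kernel_row a i \<bullet> x"
  unfolding kernel_op_def by (simp add: coord_Abs[OF kernel_op_summable])

lemma bounded_linear_kernel_op: "bounded_linear (kernel_op a)"
proof (rule bounded_linear_intro)
  show "norm (kernel_op a x) \<le> norm x * H" for x using norm_kernel_op_le[of x] by (simp add: mult.commute)
qed (rule l2_eqI, simp add: coord_kernel_op inner_add_right)+

text \<open>The bilinear form is the limit of its finite sections. Symmetry, positivity and estimates of the form are
all transferred from finite sums through this limit.\<close>
lemma kernel_form_LIMSEQ:
  "(\<lambda>n. \<Sum>i<n. \<Sum>j<n. a i j * coord x j * coord y i) \<longlonglongrightarrow> kernel_op a x \<bullet> y"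
proof -
  have "(\<lambda>n. kernel_op a (trunc n x) \<bullet> trunc n y) \<longlonglongrightarrow> kernel_op a x \<bullet> y"
    by (intro tendsto_inner bounded_linear.tendsto[OF bounded_linear_kernel_op] trunc_tendsto)
  moreover have "kernel_op a (trunc n x) \<bullet> trunc n y = (\<Sum>i<n. \<Sum>j<n. a i j * coord x j * coord y i)" for n
  proof -
    have "kernel_op a (trunc n x) \<bullet> trunc n y = trunc n y \<bullet> kernel_op a (trunc n x)"
      by (rule inner_commute)
    also have "\<dots> = (\<Sum>i<n. coord y i * (trunc n x \<bullet> kernel_row a i))"
      by (simp add: trunc_inner coord_kernel_op inner_commute)
    also have "\<dots> = (\<Sum>i<n. \<Sum>j<n. a i j * coord x j * coord y i)"
      by (simp add: trunc_inner sum_distrib_left algebra_simps)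
    finally show ?thesis .
  qed
  ultimately show ?thesis by simp
qed

lemma kernel_op_selfadjoint:
  assumes "\<And>i j. a i j = a j i"
  shows "kernel_op a x \<bullet> y = x \<bullet> kernel_op a y"
proof -
  have "(\<Sum>i<n. \<Sum>j<n. a i j * coord x j * coord y i) = (\<Sum>i<n. \<Sum>j<n. a i j * coord y j * coord x i)" for n
    by (subst sum.swap, intro sum.cong refl) (subst assms, simp)
  then have "(\<lambda>n. \<Sum>i<n. \<Sum>j<n. a i j * coord x j * coord y i) \<longlonglongrightarrow> kernel_op a y \<bullet> x"
    using kernel_form_LIMSEQ[of y x] by simp
  from LIMSEQ_unique[OF kernel_form_LIMSEQ this] show ?thesis by (simp add: inner_commute)
qed

lemma kernel_form_nonneg:
  assumes "\<And>n x. 0 \<le> (\<Sum>i<n. \<Sum>j<n. a i j * x j * x i)"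
  shows "0 \<le> kernel_op a x \<bullet> x"
  by (rule LIMSEQ_le_const[OF kernel_form_LIMSEQ]) (use assms in auto)

end

lemma kernel_form_diff_le:
  assumes "kernel_bound a H" "kernel_bound b H'" "kernel_bound (\<lambda>i j. a i j - b i j) K"
  shows "\<bar>kernel_op a x \<bullet> x - kernel_op b x \<bullet> x\<bar> \<le> K * (norm x)\<^sup>2"
proof (rule LIMSEQ_le_const2)
  show "(\<lambda>n. \<bar>(\<Sum>i<n. \<Sum>j<n. a i j * coord x j * coord x i) - (\<Sum>i<n. \<Sum>j<n. b i j * coord x j * coord x i)\<bar>)
      \<longlonglongrightarrow> \<bar>kernel_op a x \<bullet> x - kernel_op b x \<bullet> x\<bar>"
    by (intro tendsto_intros kernel_form_LIMSEQ[OF assms(1)] kernel_form_LIMSEQ[OF assms(2)])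
  show "\<exists>N. \<forall>n\<ge>N. \<bar>(\<Sum>i<n. \<Sum>j<n. a i j * coord x j * coord x i)
      - (\<Sum>i<n. \<Sum>j<n. b i j * coord x j * coord x i)\<bar> \<le> K * (norm x)\<^sup>2"
  proof (intro exI allI impI)
    fix n
    have "\<bar>(\<Sum>i<n. \<Sum>j<n. a i j * coord x j * coord x i) - (\<Sum>i<n. \<Sum>j<n. b i j * coord x j * coord x i)\<bar>
        = \<bar>\<Sum>i<n. \<Sum>j<n. (a i j - b i j) * coord x i * coord x j\<bar>"
      by (simp add: sum_subtractf[symmetric] algebra_simps)
    also have "\<dots> \<le> K * L2_set (coord x) {..<n} * L2_set (coord x) {..<n}"
      by (rule kernel_partial_form_le[OF assms(3)])
    also have "\<dots> \<le> K * norm x * norm x"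
      using kernel_bound_nonneg[OF assms(3)]
      by (intro mult_mono mult_left_mono L2_set_coord_le mult_nonneg_nonneg) auto
    finally show "\<bar>(\<Sum>i<n. \<Sum>j<n. a i j * coord x j * coord x i)
      - (\<Sum>i<n. \<Sum>j<n. b i j * coord x j * coord x i)\<bar> \<le> K * (norm x)\<^sup>2"
      by (simp add: power2_eq_square mult.assoc)
  qed
qed

lemma kernel_form_tail_le:
  assumes a: "kernel_bound a H" and tail: "kernel_bound (\<lambda>i j. if i < K \<and> j < K then 0 else a i j) e"
  shows "\<bar>kernel_op a x \<bullet> x - (\<Sum>i<K. \<Sum>j<K. a i j * coord x j * coord x i)\<bar> \<le> e * (norm x)\<^sup>2"
proof (rule LIMSEQ_le_const2)
  let ?t = "\<lambda>i j. if i < K \<and> j < K then 0 else a i j"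
  let ?S = "\<lambda>n. \<Sum>i<n. \<Sum>j<n. a i j * coord x j * coord x i"
  show "(\<lambda>n. \<bar>?S n - ?S K\<bar>) \<longlonglongrightarrow> \<bar>kernel_op a x \<bullet> x - ?S K\<bar>"
    by (intro tendsto_intros kernel_form_LIMSEQ[OF a])
  show "\<exists>N. \<forall>n\<ge>N. \<bar>?S n - ?S K\<bar> \<le> e * (norm x)\<^sup>2"
  proof (intro exI allI impI)
    fix n assume n: "K \<le> n"
    have "(\<Sum>i<n. \<Sum>j<n. (if i < K \<and> j < K then a i j * coord x j * coord x i else 0)) = ?S K"
      unfolding sum.cartesian_product using n
      by (intro sum.mono_neutral_cong_right) (auto split: if_splits)
    moreover have "?S n = (\<Sum>i<n. \<Sum>j<n. ?t i j * coord x i * coord x j)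
        + (\<Sum>i<n. \<Sum>j<n. (if i < K \<and> j < K then a i j * coord x j * coord x i else 0))"
      unfolding sum.distrib[symmetric] by (intro sum.cong refl) auto
    ultimately have "\<bar>?S n - ?S K\<bar> = \<bar>\<Sum>i<n. \<Sum>j<n. ?t i j * coord x i * coord x j\<bar>" by linarith
    also have "\<dots> \<le> e * L2_set (coord x) {..<n} * L2_set (coord x) {..<n}"
      by (rule kernel_partial_form_le[OF tail])
    also have "\<dots> \<le> e * norm x * norm x"
      using kernel_bound_nonneg[OF tail]
      by (intro mult_mono mult_left_mono L2_set_coord_le mult_nonneg_nonneg) auto
    finally show "\<bar>?S n - ?S K\<bar> \<le> e * (norm x)\<^sup>2"
      by (simp add: power2_eq_square mult.assoc)
  qed
qed

text \<open>Up to an error \<open>e \<parallel>x\<parallel>\<^sup>2\<close> the form depends on the first \<open>K\<close> coordinates of \<open>x\<close>, and these converge.\<close>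
lemma kernel_form_weakly_continuous:
  assumes a: "kernel_bound a H"
    and tails: "\<And>e. e > 0 \<Longrightarrow> \<exists>K. kernel_bound (\<lambda>i j. if i < K \<and> j < K then 0 else a i j) e"
    and X: "\<And>n. norm (X n) \<le> 1" "weak_conv X x"
  shows "(\<lambda>n. kernel_op a (X n) \<bullet> X n) \<longlonglongrightarrow> kernel_op a x \<bullet> x"
proof (rule LIMSEQ_I)
  fix r :: real assume r: "0 < r"
  define e where "e = r / (4 * (1 + (norm x)\<^sup>2))"
  have nx: "0 < 1 + (norm x)\<^sup>2" by (simp add: add_pos_nonneg)
  have e: "0 < e" using r nx by (simp add: e_def)
  obtain K where K: "kernel_bound (\<lambda>i j. if i < K \<and> j < K then 0 else a i j) e" using tails[OF e] by blast
  let ?S = "\<lambda>x. \<Sum>i<K. \<Sum>j<K. a i j * coord x j * coord x i"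
  note tail = kernel_form_tail_le[OF a K]
  have "(\<lambda>n. ?S (X n)) \<longlonglongrightarrow> ?S x"
    by (intro tendsto_intros weak_conv_coord X(2))
  from LIMSEQ_D[OF this half_gt_zero[OF r]]
  obtain n0 where n0: "\<And>n. n \<ge> n0 \<Longrightarrow> \<bar>?S (X n) - ?S x\<bar> < r / 2"
    unfolding real_norm_def by blast
  have "\<bar>kernel_op a (X n) \<bullet> X n - kernel_op a x \<bullet> x\<bar> < r" if "n \<ge> n0" for n
  proof -
    have "(norm (X n))\<^sup>2 \<le> 1" using X(1)[of n] by (simp add: power_le_one)
    then have "e * (norm (X n))\<^sup>2 \<le> e * 1" using e by (intro mult_left_mono) auto
    then have "e * (norm (X n))\<^sup>2 + e * (norm x)\<^sup>2 \<le> e * (1 + (norm x)\<^sup>2)"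
      by (simp only: distrib_left)
    also have "\<dots> = r / 4"
    proof -
      have "r / (4 * d) * d = r / 4" if "0 < d" for d :: real using that by simp
      then show ?thesis unfolding e_def using nx by blast
    qed
    finally show ?thesis using tail[of "X n"] tail[of x] n0[OF that] r by linarith
  qed
  then show "\<exists>no. \<forall>n\<ge>no. norm (kernel_op a (X n) \<bullet> X n - kernel_op a x \<bullet> x) < r"
    by auto
qed

theorem kernel_compact_psd:
  assumes a: "kernel_bound a H" and sym: "\<And>i j. a i j = a j i"
    and psd: "\<And>n x. 0 \<le> (\<Sum>i<n. \<Sum>j<n. a i j * x j * x i)"
    and tails: "\<And>e. e > 0 \<Longrightarrow> \<exists>K. kernel_bound (\<lambda>i j. if i < K \<and> j < K then 0 else a i j) e"
  shows "compact_psd (kernel_op a)"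
proof (rule compact_psd.intro)
  show "linear (kernel_op a)" by (rule bounded_linear.linear[OF bounded_linear_kernel_op[OF a]])
  show "\<exists>e :: nat \<Rightarrow> l2. orthonormal_seq e" using orthonormal_unit_l2 by blast
  show "kernel_op a x \<bullet> y = x \<bullet> kernel_op a y" for x y by (rule kernel_op_selfadjoint[OF a sym])
  show "0 \<le> kernel_op a x \<bullet> x" for x by (rule kernel_form_nonneg[OF a psd])
  show "(\<lambda>n. kernel_op a (X n) \<bullet> X n) \<longlonglongrightarrow> kernel_op a x \<bullet> x"
    if "\<And>n. norm (X n) \<le> 1" "weak_conv X x" for X x
    by (rule kernel_form_weakly_continuous[OF a tails that])
  show "\<exists>r x. strict_mono r \<and> norm x \<le> 1 \<and> weak_conv (Y \<circ> r) x" if "\<And>n. norm (Y n) \<le> 1" for Y :: "nat \<Rightarrow> l2"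
    by (rule l2_unit_ball_weakly_compact[OF that])
qed

section \<open>Growth of the divisor function\<close>

definition divisor_count :: "nat \<Rightarrow> nat" where
  "divisor_count n = card {d. d dvd n}"

lemma divisor_count_mult_le:
  assumes "0 < m" "0 < n"
  shows "divisor_count (m * n) \<le> divisor_count m * divisor_count n"
proof -
  have "{d. d dvd m * n} \<subseteq> (\<lambda>(a, b). a * b) ` ({d. d dvd m} \<times> {d. d dvd n})"
  proof
    fix d assume "d \<in> {d. d dvd m * n}"
    then obtain a b where "d = a * b" "a dvd m" "b dvd n" using division_decomp[of d m n] by auto
    then show "d \<in> (\<lambda>(a, b). a * b) ` ({d. d dvd m} \<times> {d. d dvd n})"
      by (intro image_eqI[of _ _ "(a, b)"]) auto
  qed
  then have "card {d. d dvd m * n} \<le> card ((\<lambda>(a, b). a * b) ` ({d. d dvd m} \<times> {d. d dvd n}))"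
    using assms by (intro card_mono) auto
  also have "\<dots> \<le> card ({d. d dvd m} \<times> {d. d dvd n})"
    using assms by (intro card_image_le) auto
  finally show ?thesis by (simp add: divisor_count_def card_cartesian_product)
qed

lemma sum_powr_bounded:
  assumes "s < -1"
  shows "\<exists>Z\<ge>0. \<forall>M. (\<Sum>k=1..M. real k powr s) \<le> Z"
proof -
  have s: "summable (\<lambda>k. real k powr s)" using assms by (simp add: summable_real_powr_iff)
  have "(\<Sum>k=1..M. real k powr s) \<le> (\<Sum>k. real k powr s)" for M
    by (rule sum_le_suminf[OF s]) auto
  then show ?thesis by (intro exI[of _ "\<Sum>k. real k powr s"]) (auto intro!: suminf_nonneg s)
qed

text \<open>If \<open>D\<^sub>k\<close> bounds the \<open>k\<close>-th moment, then \<open>D\<^sub>k\<^sup>2\<close> bounds the next one: one factor \<open>d(n)\<close> is written as the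
number of factorisations \<open>n = a b\<close>, and \<open>d(a b)\<^sup>k \<le> d(a)\<^sup>k d(b)\<^sup>k\<close> splits the sum over them into a product.\<close>
lemma divisor_count_moment_bounded:
  "\<exists>D\<ge>0. \<forall>N. (\<Sum>n=1..N. real (divisor_count n) ^ k * real n powr (-2)) \<le> D"
proof (induction k)
  case 0
  show ?case using sum_powr_bounded[of "-2"] by simp
next
  case (Suc k)
  define g where "g n = real (divisor_count n) ^ k * real n powr (-2)" for n
  obtain D where D: "0 \<le> D" "\<And>N. (\<Sum>n=1..N. g n) \<le> D" using Suc unfolding g_def by blast
  have g0: "0 \<le> g n" for n by (simp add: g_def)
  have gm: "g (a * b) \<le> g a * g b" if "0 < a" "0 < b" for a b
  proof -
    have "real (divisor_count (a * b)) ^ k \<le> real (divisor_count a * divisor_count b) ^ k"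
      using divisor_count_mult_le[OF that] by (intro power_mono) (auto simp del: of_nat_mult)
    then have "real (divisor_count (a * b)) ^ k * real (a * b) powr (-2)
        \<le> real (divisor_count a * divisor_count b) ^ k * real (a * b) powr (-2)"
      by (rule mult_right_mono) simp
    then show ?thesis unfolding g_def by (simp add: powr_mult power_mult_distrib mult_ac)
  qed
  have "(\<Sum>n=1..N. real (divisor_count n) ^ Suc k * real n powr (-2)) \<le> D * D" for N
  proof -
    have "(\<Sum>n=1..N. real (divisor_count n) ^ Suc k * real n powr (-2)) = (\<Sum>n=1..N. \<Sum>a | a dvd n. g n)"
      by (intro sum.cong) (auto simp: g_def divisor_count_def)
    also have "\<dots> = (\<Sum>(n, a)\<in>Sigma {1..N} (\<lambda>n. {a. a dvd n}). g n)"
      by (rule sum.Sigma) auto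
    also have "\<dots> \<le> (\<Sum>(a, b)\<in>{1..N} \<times> {1..N}. g a * g b)"
    proof (rule sum_le_included[where i = "\<lambda>(a, b). (a * b, a)"])
      show "\<forall>p\<in>Sigma {1..N} (\<lambda>n. {a. a dvd n}). \<exists>q\<in>{1..N} \<times> {1..N}.
          (case q of (a, b) \<Rightarrow> (a * b, a)) = p \<and> (case p of (n, a) \<Rightarrow> g n) \<le> (case q of (a, b) \<Rightarrow> g a * g b)"
      proof (clarify)
        fix n a b :: nat
        assume "n \<in> {1..N}" "a dvd n"
        then obtain b where b: "n = a * b" by blast
        then have "0 < a" "0 < b" "a * b \<le> N" using \<open>n \<in> {1..N}\<close> by (auto intro: Nat.gr0I)
        then have "a \<le> N" "b \<le> N"
          by (metis dual_order.trans dvd_imp_le dvd_triv_left dvd_triv_right nat_0_less_mult_iff)+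
        then show "\<exists>q\<in>{1..N} \<times> {1..N}. (case q of (a, b) \<Rightarrow> (a * b, a)) = (n, a)
            \<and> g n \<le> (case q of (a, b) \<Rightarrow> g a * g b)"
          using b gm \<open>0 < a\<close> \<open>0 < b\<close> by (intro bexI[of _ "(a, b)"]) auto
      qed
    qed (auto simp: g0)
    also have "\<dots> = (\<Sum>a=1..N. g a) * (\<Sum>b=1..N. g b)"
      by (simp add: sum_product sum.cartesian_product)
    also have "\<dots> \<le> D * D" using D by (intro mult_mono sum_nonneg g0) auto
    finally show ?thesis .
  qed
  then show ?case using D(1) by (intro exI[of _ "D * D"]) auto
qed

text \<open>A single term of the \<open>k\<close>-th moment gives \<open>d(n)\<^sup>k \<le> D n\<^sup>2\<close>; take \<open>k\<close>-th roots with \<open>2 / k \<le> \<epsilon>\<close>.\<close>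
lemma divisor_count_bound:
  assumes "0 < \<epsilon>"
  shows "\<exists>C\<ge>0. \<forall>n\<ge>1. real (divisor_count n) \<le> C * real n powr \<epsilon>"
proof -
  obtain k :: nat where k: "2 / \<epsilon> < real k" using reals_Archimedean2[of "2 / \<epsilon>"] by blast
  have "0 < 2 / \<epsilon>" using assms by simp
  then have k0: "0 < k" using k by (simp only: of_nat_0_less_iff[symmetric, where ?'a = real] less_trans)
  have k\<epsilon>: "2 / real k \<le> \<epsilon>" using k k0 assms by (simp add: field_simps)
  obtain D where D: "0 \<le> D" "\<And>N. (\<Sum>n=1..N. real (divisor_count n) ^ k * real n powr (-2)) \<le> D"
    using divisor_count_moment_bounded by blast
  have "real (divisor_count n) \<le> D powr (1 / k) * real n powr \<epsilon>" if "1 \<le> n" for n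
  proof -
    have "{d. d dvd n} \<noteq> {}" by blast
    then have d0: "0 < real (divisor_count n)"
      unfolding divisor_count_def using that by (simp add: card_gt_0_iff)
    have "real (divisor_count n) ^ k * real n powr (-2)
        \<le> (\<Sum>n=1..n. real (divisor_count n) ^ k * real n powr (-2))"
      using that by (intro member_le_sum) auto
    also note D(2)
    finally have "real (divisor_count n) ^ k \<le> D * real n powr 2"
      using that by (simp add: powr_minus field_simps)
    then have "(real (divisor_count n) ^ k) powr (1 / k) \<le> (D * real n powr 2) powr (1 / k)"
      by (intro powr_mono2) auto
    also have "(real (divisor_count n) ^ k) powr (1 / k) = real (divisor_count n)"
      using k0 d0 by (simp add: powr_powr powr_realpow[symmetric])
    also have "(D * real n powr 2) powr (1 / k) = D powr (1 / k) * real n powr (2 / k)"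
      using D(1) by (simp add: powr_mult powr_powr del: powr_numeral)
    also have "\<dots> \<le> D powr (1 / k) * real n powr \<epsilon>"
      using that k\<epsilon> by (intro mult_left_mono powr_mono) auto
    finally show ?thesis .
  qed
  then show ?thesis by (intro exI[of _ "D powr (1 / k)"]) auto
qed

section \<open>The limit operator: compactness and injectivity\<close>

definition E_kernel :: "real \<Rightarrow> nat \<Rightarrow> nat \<Rightarrow> real" where
  "E_kernel \<sigma> i j = E_entry \<sigma> (Suc i) (Suc j)"

lemma E_kernel_nonneg: "0 \<le> E_kernel \<sigma> i j"
  by (simp add: E_kernel_def E_entry_def)

lemma E_kernel_sym: "E_kernel \<sigma> i j = E_kernel \<sigma> j i"
  by (simp add: E_kernel_def E_entry_def lcm.commute mult.commute)

lemma E_entry_gcd: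
  assumes "0 < n" "0 < m"
  shows "E_entry \<sigma> n m = real n powr (\<sigma> - 1) * real m powr (\<sigma> - 1) * real (gcd n m)"
proof -
  have "real (gcd n m) * real (lcm n m) = real n * real m"
    by (metis of_nat_mult prod_gcd_lcm_nat)
  then have "real (gcd n m) = real n * real m / real (lcm n m)"
    using assms by (simp add: field_simps lcm_eq_0_iff)
  then show ?thesis using assms by (simp add: E_entry_def powr_diff)
qed

lemma E_kernel_gcd:
  "E_kernel \<sigma> i j = real (Suc i) powr (\<sigma> - 1) * real (Suc j) powr (\<sigma> - 1) * real (gcd (Suc i) (Suc j))"
  unfolding E_kernel_def by (rule E_entry_gcd) auto

text \<open>Bound \<open>gcd(n,m)\<close> by the sum of all common divisors \<open>d\<close> and sum over the multiples \<open>m = d k\<close> first;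
since \<open>1 + s \<le> 0\<close>, each divisor of \<open>n\<close> then contributes at most \<open>Z\<close>.\<close>
lemma gcd_row_sum_le:
  assumes Z: "\<And>M. (\<Sum>k=1..M. real k powr s) \<le> Z" and n: "1 \<le> n" and s: "s \<le> -1"
  shows "(\<Sum>m=1..M. real (gcd n m) * real m powr s) \<le> real (divisor_count n) * Z"
proof -
  have Z0: "0 \<le> Z" using Z[of 0] by simp
  have "(\<Sum>m=1..M. real (gcd n m) * real m powr s)
      \<le> (\<Sum>m=1..M. \<Sum>d | d dvd n. if d dvd m then real d * real m powr s else 0)"
  proof (rule sum_mono)
    fix m
    have "real (gcd n m) * real m powr s
        = (if gcd n m dvd m then real (gcd n m) * real m powr s else 0)" by simp
    also have "\<dots> \<le> (\<Sum>d | d dvd n. if d dvd m then real d * real m powr s else 0)"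
      using n by (intro member_le_sum[of "gcd n m" _ "\<lambda>d. if d dvd m then real d * real m powr s else 0"]) auto
    finally show "real (gcd n m) * real m powr s
        \<le> (\<Sum>d | d dvd n. if d dvd m then real d * real m powr s else 0)" .
  qed
  also have "\<dots> = (\<Sum>d | d dvd n. \<Sum>m=1..M. if d dvd m then real d * real m powr s else 0)"
    by (rule sum.swap)
  also have "\<dots> \<le> (\<Sum>d | d dvd n. Z)"
  proof (rule sum_mono)
    fix d assume "d \<in> {d. d dvd n}"
    then have d: "0 < d" using n by (auto intro: Nat.gr0I)
    have "(\<Sum>m=1..M. if d dvd m then real d * real m powr s else 0)
        = (\<Sum>m\<in>{m\<in>{1..M}. d dvd m}. real d * real m powr s)"
      by (rule sum.inter_filter[symmetric]) simp
    also have "\<dots> \<le> (\<Sum>k=1..M. real d * real (d * k) powr s)"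
    proof (rule sum_le_included[where i = "\<lambda>k. d * k"])
      show "\<forall>m\<in>{m\<in>{1..M}. d dvd m}. \<exists>k\<in>{1..M}. d * k = m \<and> real d * real m powr s \<le> real d * real (d * k) powr s"
      proof
        fix m assume "m \<in> {m\<in>{1..M}. d dvd m}"
        then obtain k where k: "m = d * k" "1 \<le> m" "m \<le> M" by auto
        then have "k \<le> M" "1 \<le> k" using d
          by (auto intro: Nat.gr0I order_trans[of k "d * k" M] simp: Suc_le_eq)
        then show "\<exists>k\<in>{1..M}. d * k = m \<and> real d * real m powr s \<le> real d * real (d * k) powr s"
          using k by auto
      qed
    qed auto
    also have "\<dots> = real d powr (1 + s) * (\<Sum>k=1..M. real k powr s)"
      using d by (simp add: sum_distrib_left powr_mult powr_add mult.assoc)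
    also have "\<dots> \<le> 1 * Z"
    proof (rule mult_mono)
      have "real d powr (1 + s) \<le> real d powr 0" using d s by (intro powr_mono) auto
      then show "real d powr (1 + s) \<le> 1" using d by simp
    qed (auto intro: Z[unfolded One_nat_def] sum_nonneg)
    finally show "(\<Sum>m=1..M. if d dvd m then real d * real m powr s else 0) \<le> Z" by simp
  qed
  finally show ?thesis by (simp add: divisor_count_def)
qed

text \<open>Schur's test with weight \<open>m\<^bsup>-1/2\<^esup>\<close>. The row sum at \<open>n\<close> is at most \<open>n\<^bsup>\<sigma>-1\<^esup> d(n)\<close> up to a constant, which the
divisor bound with exponent \<open>1/2 - \<sigma>\<close> turns into \<open>n\<^bsup>-1/2\<^esup>\<close>.\<close>
lemma E_kernel_bounded:
  assumes "\<sigma> < 1/2"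
  shows "\<exists>H. kernel_bound (E_kernel \<sigma>) H"
proof -
  have "\<sigma> - 3/2 < -1" using assms by simp
  then obtain Z where Z: "0 \<le> Z" "\<And>M. (\<Sum>k=1..M. real k powr (\<sigma> - 3/2)) \<le> Z"
    using sum_powr_bounded by blast
  obtain C where C: "0 \<le> C" "\<And>n. 1 \<le> n \<Longrightarrow> real (divisor_count n) \<le> C * real n powr (1/2 - \<sigma>)"
    using divisor_count_bound[of "1/2 - \<sigma>"] assms by auto
  have "kernel_bound (E_kernel \<sigma>) (C * Z)"
  proof (rule schur_test[where w = "\<lambda>j. real (Suc j) powr (-1/2)"])
    fix i M :: nat
    let ?n = "Suc i"
    have "(\<Sum>j<M. E_kernel \<sigma> i j * real (Suc j) powr (-1/2))
        = (\<Sum>j<M. real ?n powr (\<sigma> - 1) * (real (gcd ?n (Suc j)) * real (Suc j) powr (\<sigma> - 3/2)))"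
    proof (intro sum.cong refl)
      fix j
      have "real (Suc j) powr (\<sigma> - 3/2) = real (Suc j) powr (\<sigma> - 1) * real (Suc j) powr (-1/2)"
        by (subst powr_add[symmetric]) simp
      then show "E_kernel \<sigma> i j * real (Suc j) powr (-1/2)
          = real ?n powr (\<sigma> - 1) * (real (gcd ?n (Suc j)) * real (Suc j) powr (\<sigma> - 3/2))"
        by (simp add: E_kernel_gcd)
    qed
    also have "\<dots> = real ?n powr (\<sigma> - 1) * (\<Sum>m=1..M. real (gcd ?n m) * real m powr (\<sigma> - 3/2))"
      by (simp add: sum_distrib_left sum.atLeast1_atMost_eq)
    also have "\<dots> \<le> real ?n powr (\<sigma> - 1) * (real (divisor_count ?n) * Z)"
      using assms by (intro mult_left_mono gcd_row_sum_le Z) auto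
    also have "\<dots> \<le> real ?n powr (\<sigma> - 1) * ((C * real ?n powr (1/2 - \<sigma>)) * Z)"
      using Z(1) by (intro mult_left_mono mult_right_mono C) auto
    also have "\<dots> = C * Z * (real ?n powr (\<sigma> - 1) * real ?n powr (1/2 - \<sigma>))" by simp
    also have "real ?n powr (\<sigma> - 1) * real ?n powr (1/2 - \<sigma>) = real ?n powr (-1/2)"
      by (subst powr_add[symmetric]) simp
    finally show "(\<Sum>j<M. E_kernel \<sigma> i j * real (Suc j) powr (-1/2)) \<le> C * Z * real ?n powr (-1/2)" .
  qed (auto simp: E_kernel_nonneg E_kernel_sym)
  then show ?thesis by blast
qed

text \<open>Raising \<open>\<sigma>\<close> to \<open>\<tau>\<close> multiplies the entry by \<open>(n m)\<^bsup>\<tau>-\<sigma>\<^esup>\<close>. This gain makes boundedness for all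
exponents below \<open>1/2\<close> yield smallness of the tails for each of them.\<close>
lemma E_kernel_tail_le:
  assumes "\<sigma> \<le> \<tau>" "K \<le> i \<or> K \<le> j"
  shows "E_kernel \<sigma> i j \<le> real (Suc K) powr (\<sigma> - \<tau>) * E_kernel \<tau> i j"
proof -
  let ?p = "real (Suc i) * real (Suc j)"
  have le: "real (Suc K) \<le> ?p"
  proof -
    have "Suc K \<le> Suc i * Suc j" using assms(2) by auto
    then show ?thesis by (metis of_nat_le_iff of_nat_mult)
  qed
  have "E_kernel \<sigma> i j = ?p powr \<sigma> / real (lcm (Suc i) (Suc j))"
    by (simp add: E_kernel_def E_entry_def powr_mult)
  also have "?p powr \<sigma> = ?p powr (\<sigma> - \<tau>) * ?p powr \<tau>"
    by (subst powr_add[symmetric]) simp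
  also have "\<dots> / real (lcm (Suc i) (Suc j)) = ?p powr (\<sigma> - \<tau>) * E_kernel \<tau> i j"
    by (simp add: E_kernel_def E_entry_def powr_mult)
  also have "\<dots> \<le> real (Suc K) powr (\<sigma> - \<tau>) * E_kernel \<tau> i j"
    using assms(1) le by (intro mult_right_mono powr_mono2' E_kernel_nonneg) auto
  finally show ?thesis .
qed

lemma E_kernel_small_tails:
  assumes "\<sigma> < 1/2" "0 < e"
  shows "\<exists>K. kernel_bound (\<lambda>i j. if i < K \<and> j < K then 0 else E_kernel \<sigma> i j) e"
proof -
  \<comment> \<open>Any exponent strictly between \<open>\<sigma>\<close> and \<open>1/2\<close> serves.\<close>
  define \<tau> where "\<tau> = (\<sigma> + 1/2) / 2"
  have \<tau>: "\<sigma> < \<tau>" "\<tau> < 1/2" using assms(1) by (auto simp: \<tau>_def field_simps)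
  obtain H where H: "kernel_bound (E_kernel \<tau>) H" using E_kernel_bounded[OF \<tau>(2)] by blast
  have "((\<lambda>x. x powr (\<sigma> - \<tau>)) \<longlongrightarrow> 0) at_top"
    using \<tau>(1) by (intro tendsto_neg_powr filterlim_ident) auto
  then have "(\<lambda>n. real n powr (\<sigma> - \<tau>)) \<longlonglongrightarrow> 0"
    by (rule filterlim_compose) (rule filterlim_real_sequentially)
  then have "(\<lambda>K. real (Suc K) powr (\<sigma> - \<tau>) * H) \<longlonglongrightarrow> 0 * H"
    by (intro tendsto_mult tendsto_const LIMSEQ_Suc)
  then have "eventually (\<lambda>K. real (Suc K) powr (\<sigma> - \<tau>) * H < e) sequentially"
    using assms(2) by (intro order_tendstoD) auto
  then obtain K where K: "real (Suc K) powr (\<sigma> - \<tau>) * H < e"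
    by (auto simp: eventually_sequentially)
  have "kernel_bound (\<lambda>i j. if i < K \<and> j < K then 0 else E_kernel \<sigma> i j) (real (Suc K) powr (\<sigma> - \<tau>) * H)"
    using \<tau>(1)
    by (intro kernel_bound_mono[OF H]) (auto simp: E_kernel_nonneg not_less simp del: of_nat_Suc intro!: E_kernel_tail_le)
  from kernel_bound_weaken[OF this] show ?thesis using K by (auto intro: less_imp_le)
qed

lemma gcd_totient_sum:
  assumes "0 < n"
  shows "real (gcd n m) = (\<Sum>d | d dvd n. real (totient d) * of_bool (d dvd m))"
proof -
  have "gcd n m = (\<Sum>d | d dvd gcd n m. totient d)" by (rule totient_divisor_sum[symmetric])
  also have "\<dots> = (\<Sum>d\<in>{d\<in>{d. d dvd n}. d dvd m}. totient d)"
    by (intro sum.cong) auto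
  also have "\<dots> = (\<Sum>d | d dvd n. if d dvd m then totient d else 0)"
    using assms by (intro sum.inter_filter) auto
  finally have "real (gcd n m) = real (\<Sum>d | d dvd n. if d dvd m then totient d else 0)" by simp
  also have "\<dots> = (\<Sum>d | d dvd n. real (totient d) * of_bool (d dvd m))"
    unfolding of_nat_sum by (intro sum.cong) auto
  finally show ?thesis .
qed

text \<open>By \<open>gcd(n,m) = \<Sum>\<^bsub>d | n, d | m\<^esub> \<phi>(d)\<close> the form is a sum of squares with weights \<open>\<phi>(d)\<close>.\<close>
lemma E_kernel_psd: "0 \<le> (\<Sum>i<n. \<Sum>j<n. E_kernel \<sigma> i j * x j * x i)"
proof -
  define z where "z d i = of_bool (d dvd Suc i) * real (Suc i) powr (\<sigma> - 1) * x i" for d i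
  have "(\<Sum>i<n. \<Sum>j<n. E_kernel \<sigma> i j * x j * x i)
      = (\<Sum>i<n. \<Sum>j<n. \<Sum>d=1..n. real (totient d) * (z d i * z d j))"
  proof (intro sum.cong refl)
    fix i j assume "i \<in> {..<n}"
    have "real (gcd (Suc i) (Suc j)) = (\<Sum>d | d dvd Suc i. real (totient d) * of_bool (d dvd Suc j))"
      by (rule gcd_totient_sum) simp
    also have "\<dots> = (\<Sum>d=1..n. real (totient d) * (of_bool (d dvd Suc i) * of_bool (d dvd Suc j)))"
    proof (rule sum.mono_neutral_cong_left)
      show "{d. d dvd Suc i} \<subseteq> {1..n}"
      proof
        fix d assume "d \<in> {d. d dvd Suc i}"
        then have "d \<le> Suc i" "0 < d" using dvd_imp_le dvd_pos_nat by auto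
        then show "d \<in> {1..n}" using \<open>i \<in> {..<n}\<close> by auto
      qed
    qed auto
    finally have g: "real (gcd (Suc i) (Suc j)) = \<dots>" .
    show "E_kernel \<sigma> i j * x j * x i = (\<Sum>d=1..n. real (totient d) * (z d i * z d j))"
      unfolding E_kernel_gcd g z_def sum_distrib_left sum_distrib_right
      by (intro sum.cong refl) (simp only: mult_ac)
  qed
  also have "\<dots> = (\<Sum>i<n. \<Sum>d=1..n. \<Sum>j<n. real (totient d) * (z d i * z d j))"
    by (intro sum.cong refl sum.swap)
  also have "\<dots> = (\<Sum>d=1..n. \<Sum>i<n. \<Sum>j<n. real (totient d) * (z d i * z d j))"
    by (rule sum.swap)
  also have "\<dots> = (\<Sum>d=1..n. real (totient d) * (\<Sum>i<n. z d i)\<^sup>2)"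
    unfolding power2_eq_square sum_product by (simp only: sum_distrib_left)
  also have "\<dots> \<ge> 0" by (intro sum_nonneg) auto
  finally show ?thesis .
qed

theorem E_kernel_compact_psd:
  assumes "\<sigma> < 1/2"
  shows "compact_psd (kernel_op (E_kernel \<sigma>))"
proof -
  obtain H where H: "kernel_bound (E_kernel \<sigma>) H" using E_kernel_bounded[OF assms] by blast
  show ?thesis
    by (rule kernel_compact_psd[OF H E_kernel_sym E_kernel_psd E_kernel_small_tails[OF assms]])
qed

lemma summable_of_bool_mult:
  fixes z :: "nat \<Rightarrow> real"
  assumes "summable (\<lambda>j. \<bar>z j\<bar>)"
  shows "summable (\<lambda>j. of_bool (Q j) * z j)"
  by (rule summable_comparison_test'[OF assms, where N = 0]) (auto simp: of_bool_def)

text \<open>The sums \<open>Y d\<close> over the multiples of \<open>d\<close> satisfy \<open>\<Sum>\<^bsub>d | n\<^esub> \<phi>(d) Y d = 0\<close> for every \<open>n\<close>; since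
\<open>\<phi>(n) \<noteq> 0\<close>, this triangular system has only the zero solution.\<close>
lemma multiples_sums_zero:
  fixes z :: "nat \<Rightarrow> real"
  assumes z: "summable (\<lambda>j. \<bar>z j\<bar>)"
    and gcd0: "\<And>n. 0 < n \<Longrightarrow> (\<lambda>j. real (gcd n (Suc j)) * z j) sums 0"
    and n: "0 < n"
  shows "(\<Sum>j. of_bool (n dvd Suc j) * z j) = 0"
  using n
proof (induction n rule: less_induct)
  case (less n)
  let ?Y = "\<lambda>d. \<Sum>j. of_bool (d dvd Suc j) * z j"
  have "(\<lambda>j. \<Sum>d | d dvd n. real (totient d) * (of_bool (d dvd Suc j) * z j))
      sums (\<Sum>d | d dvd n. real (totient d) * ?Y d)"
    by (intro sums_sum sums_mult summable_sums summable_of_bool_mult z)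
  moreover have "(\<Sum>d | d dvd n. real (totient d) * (of_bool (d dvd Suc j) * z j))
      = real (gcd n (Suc j)) * z j" for j
    unfolding gcd_totient_sum[OF less.prems] sum_distrib_right by (simp add: mult.assoc)
  ultimately have "(\<Sum>d | d dvd n. real (totient d) * ?Y d) = 0"
    using sums_unique2[OF gcd0[OF less.prems]] by simp
  moreover have "(\<Sum>d | d dvd n. real (totient d) * ?Y d)
      = (\<Sum>d\<in>{n}. real (totient d) * ?Y d)"
  proof (rule sum.mono_neutral_right)
    show "\<forall>d\<in>{d. d dvd n} - {n}. real (totient d) * ?Y d = 0"
    proof
      fix d assume "d \<in> {d. d dvd n} - {n}"
      then have "0 < d" "d < n" using less.prems by (auto dest: dvd_imp_le dvd_pos_nat simp: le_less)
      then show "real (totient d) * ?Y d = 0" using less.IH by simp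
    qed
  qed (use less.prems in auto)
  ultimately show ?case using less.prems by simp
qed

text \<open>Inclusion and exclusion, one prime at a time: the multiples \<open>d k\<close> with \<open>k\<close> free of the primes in
\<open>P\<close>, minus those where \<open>p\<close> divides \<open>k\<close>, which are of the same kind with \<open>d p\<close> in place of \<open>d\<close>.\<close>
lemma sieved_sums_zero:
  fixes z :: "nat \<Rightarrow> real"
  assumes z: "summable (\<lambda>j. \<bar>z j\<bar>)"
    and multiples: "\<And>n. 0 < n \<Longrightarrow> (\<Sum>j. of_bool (n dvd Suc j) * z j) = 0"
    and P: "finite P" "\<And>p. p \<in> P \<Longrightarrow> prime p" and d: "0 < d"
  shows "(\<Sum>j. of_bool (d dvd Suc j \<and> (\<forall>p\<in>P. \<not> p dvd Suc j div d)) * z j) = 0"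
  using P d
proof (induction P arbitrary: d rule: finite_induct)
  case empty
  then show ?case using multiples by simp
next
  case (insert p P)
  let ?I = "\<lambda>P d j. of_bool (d dvd Suc j \<and> (\<forall>p\<in>P. \<not> p dvd Suc j div d)) :: real"
  have p: "prime p" "0 < p" using insert.prems(1)[of p] by (auto simp: prime_gt_0_nat)
  have "?I (insert p P) d j = ?I P d j - ?I P (d * p) j" for j
  proof (cases "d dvd Suc j \<and> p dvd Suc j div d")
    case True
    then obtain k where k: "Suc j = d * (p * k)" by (metis dvd_def dvd_mult_div_cancel)
    have "q dvd p * k \<longleftrightarrow> q dvd k" if "q \<in> P" for q
    proof -
      have "prime q" "q \<noteq> p" using insert that by auto
      then have "\<not> q dvd p" using p(1) primes_dvd_imp_eq by blast
      then show ?thesis using \<open>prime q\<close> by (auto simp: prime_dvd_mult_iff)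
    qed
    moreover have "Suc j div d = p * k" "Suc j div (d * p) = k" "d * p dvd Suc j"
      unfolding k using insert.prems(2) p(2) by (simp_all add: mult.assoc[symmetric])
    ultimately show ?thesis using True by simp
  next
    case False
    then have "\<not> d * p dvd Suc j" using insert.prems(2)
      by (auto elim!: dvdE simp: mult.assoc)
    then show ?thesis using False by auto
  qed
  then have "(\<Sum>j. ?I (insert p P) d j * z j) = (\<Sum>j. ?I P d j * z j - ?I P (d * p) j * z j)"
    by (simp only: left_diff_distrib)
  also have "\<dots> = (\<Sum>j. ?I P d j * z j) - (\<Sum>j. ?I P (d * p) j * z j)"
    by (intro suminf_diff[symmetric] summable_of_bool_mult z)
  also have "\<dots> = 0" using insert p by simp
  finally show ?case .
qed

text \<open>Sieving by all primes up to \<open>q\<close> leaves, among the multiples \<open>d k\<close> of \<open>d = i + 1\<close>, the one with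
\<open>k = 1\<close> and some with \<open>k > q\<close>. Hence \<open>\<bar>z i\<bar>\<close> is at most the tail beyond \<open>q\<close> of a convergent series.\<close>
lemma gcd_transform_injective:
  fixes z :: "nat \<Rightarrow> real"
  assumes z: "summable (\<lambda>j. \<bar>z j\<bar>)"
    and gcd0: "\<And>n. 0 < n \<Longrightarrow> (\<lambda>j. real (gcd n (Suc j)) * z j) sums 0"
  shows "z i = 0"
proof -
  let ?d = "Suc i"
  have "\<bar>z i\<bar> \<le> (\<Sum>j. \<bar>z j\<bar>) - (\<Sum>j<q. \<bar>z j\<bar>)" if q: "i < q" for q
  proof -
    define Q where "Q j \<longleftrightarrow> ?d dvd Suc j \<and> (\<forall>p\<in>{p. prime p \<and> p \<le> q}. \<not> p dvd Suc j div ?d)" for j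
    have "(\<Sum>j. of_bool (Q j) * z j) = 0"
      unfolding Q_def by (rule sieved_sums_zero[OF z multiples_sums_zero[OF z gcd0]]) auto
    then have "(\<lambda>j. of_bool (Q j) * z j) sums 0"
      using summable_sums[OF summable_of_bool_mult[OF z, of Q]] by simp
    then have "(\<lambda>j. of_bool (Q (j + q)) * z (j + q)) sums (0 - (\<Sum>j<q. of_bool (Q j) * z j))"
      by (subst sums_iff_shift) (simp)
    moreover have "(\<Sum>j<q. of_bool (Q j) * z j) = (\<Sum>j\<in>{i}. of_bool (Q j) * z j)"
    proof (rule sum.mono_neutral_right)
      show "\<forall>j\<in>{..<q} - {i}. of_bool (Q j) * z j = 0"
      proof
        fix j assume j: "j \<in> {..<q} - {i}"
        have "\<not> Q j"
        proof
          assume Q: "Q j"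
          then obtain k where k: "Suc j = ?d * k" unfolding Q_def by (elim conjE dvdE)
          then have "k \<noteq> 1" using j by auto
          then obtain p where p: "prime p" "p dvd k" using prime_factor_nat by blast
          have "0 < k" using k by (intro Nat.gr0I) auto
          then have "p \<le> k" using p(2) by (rule dvd_imp_le[rotated])
          also have "k \<le> Suc j" unfolding k by simp
          finally have "p \<le> q" using j by simp
          moreover have "Suc j div ?d = k" unfolding k by (simp del: mult_Suc)
          ultimately show False using Q p unfolding Q_def by auto
        qed
        then show "of_bool (Q j) * z j = 0" by simp
      qed
    qed (use q in auto)
    moreover have "Q i"
      unfolding Q_def by (auto simp: not_prime_1 prime_nat_iff)
    ultimately have "(\<lambda>j. of_bool (Q (j + q)) * z (j + q)) sums (- z i)" by simp
    moreover have sz: "summable (\<lambda>j. \<bar>z (j + q)\<bar>)"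
      using z summable_iff_shift[of "\<lambda>j. \<bar>z j\<bar>" q] by simp
    ultimately have "\<bar>- z i\<bar> \<le> (\<Sum>j. \<bar>z (j + q)\<bar>)"
    proof -
      assume s: "(\<lambda>j. of_bool (Q (j + q)) * z (j + q)) sums (- z i)"
      have sa: "summable (\<lambda>j. \<bar>of_bool (Q (j + q)) * z (j + q)\<bar>)"
        by (rule summable_comparison_test'[OF sz, where N = 0]) (auto simp: of_bool_def)
      have "\<bar>- z i\<bar> \<le> (\<Sum>j. \<bar>of_bool (Q (j + q)) * z (j + q)\<bar>)"
        using summable_rabs[OF sa] sums_unique[OF s] by simp
      also have "\<dots> \<le> (\<Sum>j. \<bar>z (j + q)\<bar>)"
        by (intro suminf_le sa sz) (auto simp: of_bool_def)
      finally show ?thesis .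
    qed
    also have "\<dots> = (\<Sum>j. \<bar>z j\<bar>) - (\<Sum>j<q. \<bar>z j\<bar>)"
      using suminf_minus_initial_segment[OF z, of q] by simp
    finally show ?thesis by simp
  qed
  moreover have "(\<lambda>q. (\<Sum>j. \<bar>z j\<bar>) - (\<Sum>j<q. \<bar>z j\<bar>)) \<longlonglongrightarrow> (\<Sum>j. \<bar>z j\<bar>) - (\<Sum>j. \<bar>z j\<bar>)"
    by (intro tendsto_diff tendsto_const summable_LIMSEQ z)
  ultimately have "\<bar>z i\<bar> \<le> (\<Sum>j. \<bar>z j\<bar>) - (\<Sum>j. \<bar>z j\<bar>)"
    by (intro LIMSEQ_le_const) (auto intro!: exI[of _ "Suc i"])
  then show ?thesis by simp
qed

text \<open>With \<open>z j = (j+1)\<^bsup>\<sigma>-1\<^esup> x j\<close> the equation becomes \<open>\<Sum>\<^sub>j gcd(n,j+1) z j = 0\<close>; the sequence \<open>z\<close> is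
absolutely summable because \<open>\<Sum>\<^sub>j j\<^bsup>2\<sigma>-2\<^esup>\<close> converges.\<close>
theorem E_kernel_injective:
  assumes \<sigma>: "\<sigma> < 1/2" and x: "kernel_op (E_kernel \<sigma>) x = 0"
  shows "x = 0"
proof (rule l2_eqI)
  fix i
  obtain H where H: "kernel_bound (E_kernel \<sigma>) H" using E_kernel_bounded[OF \<sigma>] by blast
  define z where "z j = real (Suc j) powr (\<sigma> - 1) * coord x j" for j
  have "summable (\<lambda>j. real (Suc j) powr (2 * \<sigma> - 2))"
    using \<sigma> summable_Suc_iff[of "\<lambda>j. real j powr (2 * \<sigma> - 2)"] by (simp add: summable_real_powr_iff)
  then have "summable (\<lambda>j. (real (Suc j) powr (\<sigma> - 1))\<^sup>2)"
    by (simp add: powr_power algebra_simps)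
  then have z: "summable (\<lambda>j. \<bar>z j\<bar>)"
    unfolding z_def by (rule summable_mult_l2(1)) (rule summable_coord)
  have "(\<lambda>j. real (gcd n (Suc j)) * z j) sums 0" if n: "0 < n" for n
  proof -
    obtain k where k: "n = Suc k" using n by (cases n) auto
    have "kernel_row (E_kernel \<sigma>) k \<bullet> x = 0"
      using coord_kernel_op[OF H, of x k] x by simp
    then have "(\<lambda>j. E_kernel \<sigma> k j * coord x j) sums 0"
      using inner_l2_sums[of "kernel_row (E_kernel \<sigma>) k" x] by (simp add: coord_kernel_row[OF H])
    then have "(\<lambda>j. real n powr (1 - \<sigma>) * (E_kernel \<sigma> k j * coord x j)) sums (real n powr (1 - \<sigma>) * 0)"
      by (rule sums_mult)
    moreover have "real n powr (1 - \<sigma>) * (E_kernel \<sigma> k j * coord x j) = real (gcd n (Suc j)) * z j" for j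
    proof -
      have "real n powr (1 - \<sigma>) * real n powr (\<sigma> - 1) = 1"
        using n by (subst powr_add[symmetric]) simp
      then show ?thesis unfolding E_kernel_gcd z_def k by (simp add: mult_ac)
    qed
    ultimately show ?thesis by simp
  qed
  from gcd_transform_injective[OF z this] have "z i = 0" .
  then show "coord x i = coord 0 i" by (simp add: z_def)
qed

section \<open>Asymptotics of the Gram matrices\<close>

definition power_sum :: "real \<Rightarrow> nat \<Rightarrow> real" where
  "power_sum \<rho> M = (\<Sum>j=1..M. real j powr (\<rho> - 1))"

text \<open>By the mean value theorem \<open>(M+1)\<^sup>\<rho> - M\<^sup>\<rho> = \<rho> \<xi>\<^bsup>\<rho>-1\<^esup>\<close> with \<open>M < \<xi> < M+1\<close>, so each step changes the
error by at most \<open>\<rho> \<bar>(M+1)\<^bsup>\<rho>-1\<^esup> - M\<^bsup>\<rho>-1\<^esup>\<bar>\<close>, with constant sign. These bounds telescope.\<close>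
lemma power_sum_approx:
  assumes \<rho>: "0 < \<rho>" and M: "1 \<le> M"
  shows "\<bar>\<rho> * power_sum \<rho> M - real M powr \<rho> - (\<rho> - 1)\<bar> \<le> \<bar>\<rho> * real M powr (\<rho> - 1) - \<rho>\<bar>"
proof -
  let ?D = "\<lambda>M. \<rho> * power_sum \<rho> M - real M powr \<rho> - (\<rho> - 1)"
  have "(1 \<le> \<rho> \<longrightarrow> 0 \<le> ?D M \<and> ?D M \<le> \<rho> * real M powr (\<rho> - 1) - \<rho>) \<and>
        (\<rho> \<le> 1 \<longrightarrow> ?D M \<le> 0 \<and> \<rho> * real M powr (\<rho> - 1) - \<rho> \<le> ?D M)"
    using M
  proof (induction M rule: dec_induct)
    case base
    show ?case by (simp add: power_sum_def)
  next
    case (step M)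
    let ?M = "real M" and ?M' = "real (Suc M)"
    have M: "0 < ?M" using step by simp
    have "\<exists>\<xi>>?M. \<xi> < ?M' \<and> ?M' powr \<rho> - ?M powr \<rho> = (?M' - ?M) * (\<rho> * \<xi> powr (\<rho> - 1))"
    proof (rule MVT2)
      fix x assume "?M \<le> x" "x \<le> ?M'"
      then show "((\<lambda>x. x powr \<rho>) has_real_derivative \<rho> * x powr (\<rho> - 1)) (at x)"
        using M by (intro has_real_derivative_powr) auto
    qed simp
    then obtain \<xi> where \<xi>: "?M < \<xi>" "\<xi> < ?M'"
      and mvt: "?M' powr \<rho> - ?M powr \<rho> = \<rho> * \<xi> powr (\<rho> - 1)" by auto
    have "\<rho> * power_sum \<rho> (Suc M) = \<rho> * power_sum \<rho> M + \<rho> * ?M' powr (\<rho> - 1)"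
      by (simp add: power_sum_def distrib_left)
    then have D: "?D (Suc M) = ?D M + \<rho> * ?M' powr (\<rho> - 1) - \<rho> * \<xi> powr (\<rho> - 1)"
      using mvt by linarith
    have "\<rho> * ?M powr (\<rho> - 1) \<le> \<rho> * \<xi> powr (\<rho> - 1) \<and> \<rho> * \<xi> powr (\<rho> - 1) \<le> \<rho> * ?M' powr (\<rho> - 1)"
      if "1 \<le> \<rho>" using that \<xi> M \<rho> by (intro conjI mult_left_mono powr_mono2) auto
    moreover have "\<rho> * \<xi> powr (\<rho> - 1) \<le> \<rho> * ?M powr (\<rho> - 1) \<and> \<rho> * ?M' powr (\<rho> - 1) \<le> \<rho> * \<xi> powr (\<rho> - 1)"
      if "\<rho> \<le> 1" using that \<xi> M \<rho> by (intro conjI mult_left_mono powr_mono2') auto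
    ultimately show ?case using step.IH unfolding D by linarith
  qed
  then show ?thesis by linarith
qed

lemma power_sum_nonneg: "0 \<le> power_sum \<rho> M"
  by (auto simp: power_sum_def intro: sum_nonneg)

lemma power_sum_relative_error:
  assumes \<rho>: "0 < \<rho>" and M: "1 \<le> M"
  shows "\<bar>\<rho> * power_sum \<rho> M / real M powr \<rho> - 1\<bar> \<le> (\<bar>\<rho> - 1\<bar> + \<rho>) * real M powr (- \<rho>) + \<rho> * real M powr (-1)"
proof -
  have M0: "0 < real M powr \<rho>" using M by simp
  have "\<bar>\<rho> * power_sum \<rho> M - real M powr \<rho>\<bar> \<le> (\<bar>\<rho> - 1\<bar> + \<rho>) + \<rho> * real M powr (\<rho> - 1)"
  proof -
    have "0 \<le> \<rho> * real M powr (\<rho> - 1)" using \<rho> by simp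
    then show ?thesis using power_sum_approx[OF assms] \<rho> by linarith
  qed
  then have "\<bar>\<rho> * power_sum \<rho> M - real M powr \<rho>\<bar> / real M powr \<rho>
      \<le> ((\<bar>\<rho> - 1\<bar> + \<rho>) + \<rho> * real M powr (\<rho> - 1)) / real M powr \<rho>"
    using M0 by (intro divide_right_mono) auto
  also have "\<dots> = (\<bar>\<rho> - 1\<bar> + \<rho>) * real M powr (- \<rho>) + \<rho> * (real M powr (\<rho> - 1) * real M powr (- \<rho>))"
    unfolding powr_minus divide_inverse by (simp only: distrib_right mult.assoc)
  also have "real M powr (\<rho> - 1) * real M powr (- \<rho>) = real M powr (-1)"
    by (subst powr_add[symmetric]) simp
  also have "\<bar>\<rho> * power_sum \<rho> M - real M powr \<rho>\<bar> / real M powr \<rho> = \<bar>\<rho> * power_sum \<rho> M / real M powr \<rho> - 1\<bar>"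
  proof -
    have "\<rho> * power_sum \<rho> M / real M powr \<rho> - 1 = (\<rho> * power_sum \<rho> M - real M powr \<rho>) / real M powr \<rho>"
      using M0 by (simp add: diff_divide_distrib)
    then show ?thesis using M0 by (simp add: abs_divide)
  qed
  finally show ?thesis .
qed

lemma power_sum_asymptotics:
  assumes \<rho>: "0 < \<rho>"
  shows "(\<lambda>M. \<rho> * power_sum \<rho> M / real M powr \<rho>) \<longlonglongrightarrow> 1"
proof -
  have "((\<lambda>x. x powr (- a)) \<longlongrightarrow> 0) at_top" if "0 < a" for a :: real
    using that by (intro tendsto_neg_powr filterlim_ident) auto
  then have p: "(\<lambda>M. real M powr (- a)) \<longlonglongrightarrow> 0" if "0 < a" for a :: real
    by (rule filterlim_compose[OF _ filterlim_real_sequentially]) (rule that)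
  have p1: "(\<lambda>M. real M powr (-1)) \<longlonglongrightarrow> 0" by (rule p) simp
  have "(\<lambda>M. (\<bar>\<rho> - 1\<bar> + \<rho>) * real M powr (- \<rho>) + \<rho> * real M powr (-1)) \<longlonglongrightarrow> (\<bar>\<rho> - 1\<bar> + \<rho>) * 0 + \<rho> * 0"
    by (intro tendsto_add tendsto_mult tendsto_const p[OF \<rho>] p1)
  then have lim: "(\<lambda>M. (\<bar>\<rho> - 1\<bar> + \<rho>) * real M powr (- \<rho>) + \<rho> * real M powr (-1)) \<longlonglongrightarrow> 0" by simp
  have "(\<lambda>M. \<rho> * power_sum \<rho> M / real M powr \<rho> - 1) \<longlonglongrightarrow> 0"
  proof (rule Lim_null_comparison[OF _ lim])
    show "\<forall>\<^sub>F M in sequentially. norm (\<rho> * power_sum \<rho> M / real M powr \<rho> - 1)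
        \<le> (\<bar>\<rho> - 1\<bar> + \<rho>) * real M powr (- \<rho>) + \<rho> * real M powr (-1)"
      unfolding real_norm_def
      by (rule eventually_sequentiallyI[of 1]) (rule power_sum_relative_error[OF \<rho>])
  qed
  then show ?thesis by (rule LIM_zero_cancel)
qed

lemma power_sum_le:
  assumes \<rho>: "0 < \<rho>"
  shows "\<exists>C\<ge>0. \<forall>M. \<rho> * power_sum \<rho> M \<le> C * real M powr \<rho>"
proof -
  have "Bseq (\<lambda>M. \<rho> * power_sum \<rho> M / real M powr \<rho>)"
    by (rule convergent_imp_Bseq[OF convergentI[OF power_sum_asymptotics[OF \<rho>]]])
  then obtain C where C: "0 < C" "\<And>M. norm (\<rho> * power_sum \<rho> M / real M powr \<rho>) \<le> C"
    by (auto simp: Bseq_def)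
  have "\<rho> * power_sum \<rho> M \<le> C * real M powr \<rho>" for M
  proof (cases "M = 0")
    case False
    then have M0: "0 < real M powr \<rho>" by simp
    have "\<rho> * power_sum \<rho> M / real M powr \<rho> \<le> C" using C(2)[of M] unfolding real_norm_def by (rule abs_le_D1)
    then show ?thesis using M0 by (simp add: pos_divide_le_eq)
  qed (simp add: power_sum_def)
  then show ?thesis using C(1) by (intro exI[of _ C]) auto
qed

text \<open>The factor by which an entry of the scaled Gram matrix with least common multiple \<open>L\<close> differs from the
corresponding entry of \<open>E(\<sigma>,1)\<close>.\<close>
definition sampling_ratio :: "real \<Rightarrow> nat \<Rightarrow> nat \<Rightarrow> real" where
  "sampling_ratio \<rho> N L = \<rho> * power_sum \<rho> (N div L) * (real L / real N) powr \<rho>"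

lemma sampling_ratio_nonneg: "0 < \<rho> \<Longrightarrow> 0 \<le> sampling_ratio \<rho> N L"
  by (simp add: sampling_ratio_def power_sum_nonneg)

lemma sampling_ratio_eq_0: "N < L \<Longrightarrow> sampling_ratio \<rho> N L = 0"
  by (simp add: sampling_ratio_def power_sum_def)

lemma div_mult_ratio_le_1: "real (N div L) * (real L / real N) \<le> 1"
proof -
  have "N div L * L \<le> N" by simp
  then have "real (N div L) * real L \<le> real N" by (metis of_nat_le_iff of_nat_mult)
  then show ?thesis by (simp add: divide_le_eq)
qed

lemma sampling_ratio_le:
  assumes \<rho>: "0 < \<rho>"
  shows "\<exists>C\<ge>0. \<forall>N L. sampling_ratio \<rho> N L \<le> C"
proof -
  obtain C where C: "0 \<le> C" "\<And>M. \<rho> * power_sum \<rho> M \<le> C * real M powr \<rho>"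
    using power_sum_le[OF \<rho>] by blast
  have "sampling_ratio \<rho> N L \<le> C" for N L
  proof -
    have "sampling_ratio \<rho> N L \<le> C * real (N div L) powr \<rho> * (real L / real N) powr \<rho>"
      unfolding sampling_ratio_def by (intro mult_right_mono C) auto
    also have "\<dots> = C * (real (N div L) * (real L / real N)) powr \<rho>"
      by (subst powr_mult) (simp_all only: mult.assoc)
    also have "\<dots> \<le> C * 1 powr \<rho>"
      using \<rho> C(1) by (intro mult_left_mono powr_mono2 div_mult_ratio_le_1) auto
    finally show ?thesis by simp
  qed
  then show ?thesis using C(1) by blast
qed

text \<open>With \<open>M = N div L\<close> the ratio is \<open>\<rho> (\<Sum>\<^bsub>j\<le>M\<^esub> j\<^bsup>\<rho>-1\<^esup>) / M\<^sup>\<rho>\<close> times \<open>(M L / N)\<^sup>\<rho>\<close>, and both factors tend to 1.\<close>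
lemma sampling_ratio_tendsto:
  assumes \<rho>: "0 < \<rho>" and L: "0 < L"
  shows "(\<lambda>N. sampling_ratio \<rho> N L) \<longlonglongrightarrow> 1"
proof -
  have div: "filterlim (\<lambda>N. N div L) sequentially sequentially"
    unfolding filterlim_at_top
    using L by (auto intro!: eventually_sequentiallyI simp: less_eq_div_iff_mult_less_eq)
  have "(\<lambda>N. real L / real N) \<longlonglongrightarrow> 0" by (rule lim_const_over_n)
  then have "(\<lambda>N. real (N div L) * (real L / real N) - 1) \<longlonglongrightarrow> 0"
  proof (rule Lim_null_comparison[rotated], intro eventually_sequentiallyI[of 1])
    fix N :: nat assume N: "1 \<le> N"
    have "real N = real (N div L) * real L + real (N mod L)"
      by (metis div_mult_mod_eq of_nat_add of_nat_mult)
    then have "real (N div L) * (real L / real N) - 1 = - (real (N mod L) / real N)"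
      using N by (simp add: field_simps)
    moreover have "real (N mod L) / real N \<le> real L / real N"
      using L by (intro divide_right_mono) (auto intro: less_imp_le mod_less_divisor)
    ultimately show "norm (real (N div L) * (real L / real N) - 1) \<le> real L / real N" by simp
  qed
  then have "(\<lambda>N. real (N div L) * (real L / real N)) \<longlonglongrightarrow> 1" by (rule LIM_zero_cancel)
  then have "(\<lambda>N. (real (N div L) * (real L / real N)) powr \<rho>) \<longlonglongrightarrow> 1 powr \<rho>"
    by (intro tendsto_powr tendsto_const) auto
  moreover have "(\<lambda>N. \<rho> * power_sum \<rho> (N div L) / real (N div L) powr \<rho>) \<longlonglongrightarrow> 1"
    by (rule filterlim_compose[OF power_sum_asymptotics[OF \<rho>] div])
  ultimately have "(\<lambda>N. (\<rho> * power_sum \<rho> (N div L) / real (N div L) powr \<rho>)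
      * (real (N div L) * (real L / real N)) powr \<rho>) \<longlonglongrightarrow> 1 * 1 powr \<rho>"
    by (intro tendsto_mult)
  moreover have "\<forall>\<^sub>F N in sequentially. (\<rho> * power_sum \<rho> (N div L) / real (N div L) powr \<rho>)
      * (real (N div L) * (real L / real N)) powr \<rho> = sampling_ratio \<rho> N L"
  proof (rule eventually_sequentiallyI[of L])
    fix N assume "L \<le> N"
    then have "0 < N div L" using L by (simp add: div_greater_zero_iff)
    then have "real (N div L) powr \<rho> \<noteq> 0" by simp
    then show "(\<rho> * power_sum \<rho> (N div L) / real (N div L) powr \<rho>)
      * (real (N div L) * (real L / real N)) powr \<rho> = sampling_ratio \<rho> N L"
      unfolding sampling_ratio_def by (subst powr_mult) simp
  qed
  ultimately show ?thesis by (simp add: filterlim_cong[OF refl refl])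
qed

definition T_entry :: "real \<Rightarrow> nat \<Rightarrow> nat \<Rightarrow> real" where
  "T_entry \<sigma> k i = (if Suc i dvd Suc k then (real (Suc k) / real (Suc i)) powr (- \<sigma>) else 0)"

definition gram_kernel :: "real \<Rightarrow> nat \<Rightarrow> nat \<Rightarrow> nat \<Rightarrow> real" where
  "gram_kernel \<sigma> N i j = E_kernel \<sigma> i j * sampling_ratio (1 - 2 * \<sigma>) N (lcm (Suc i) (Suc j))"

text \<open>A row \<open>k\<close> contributes exactly when both column indices divide it, that is when
it is a multiple of their least common multiple.\<close>
lemma gram_sum:
  "(\<Sum>k<N. T_entry \<sigma> k i * T_entry \<sigma> k j)
     = (real (Suc i) * real (Suc j)) powr \<sigma> * real (lcm (Suc i) (Suc j)) powr (- 2 * \<sigma>)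
       * power_sum (1 - 2 * \<sigma>) (N div lcm (Suc i) (Suc j))"
proof -
  let ?m = "real (Suc i)" and ?m' = "real (Suc j)"
  define L where "L = lcm (Suc i) (Suc j)"
  have L: "0 < L" unfolding L_def by (rule lcm_pos_nat) auto
  have "(\<Sum>k<N. T_entry \<sigma> k i * T_entry \<sigma> k j)
      = (\<Sum>k=1..N. if L dvd k then (?m * ?m') powr \<sigma> * real k powr (- 2 * \<sigma>) else 0)"
    unfolding One_nat_def sum.atLeast1_atMost_eq
  proof (intro sum.cong refl)
    fix k
    have "(real (Suc k) / m) powr (- \<sigma>) = real (Suc k) powr (- \<sigma>) * m powr \<sigma>" if "0 < m" for m :: real
      using that by (simp add: powr_divide powr_minus field_simps)
    moreover have "real (Suc k) powr (- 2 * \<sigma>) = real (Suc k) powr (- \<sigma>) * real (Suc k) powr (- \<sigma>)"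
      by (subst powr_add[symmetric]) simp
    ultimately show "T_entry \<sigma> k i * T_entry \<sigma> k j
        = (if L dvd Suc k then (?m * ?m') powr \<sigma> * real (Suc k) powr (- 2 * \<sigma>) else 0)"
      by (simp add: T_entry_def L_def powr_mult mult_ac)
  qed
  also have "\<dots> = (\<Sum>k\<in>{k\<in>{1..N}. L dvd k}. (?m * ?m') powr \<sigma> * real k powr (- 2 * \<sigma>))"
    by (rule sum.inter_filter[symmetric]) simp
  also have "\<dots> = (\<Sum>j=1..N div L. (?m * ?m') powr \<sigma> * real (L * j) powr (- 2 * \<sigma>))"
  proof (rule sum.reindex_bij_witness[where i = "\<lambda>j. L * j" and j = "\<lambda>k. k div L"])
    fix k assume "k \<in> {k \<in> {1..N}. L dvd k}"
    then obtain q where q: "k = L * q" "1 \<le> k" "k \<le> N" by auto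
    then have "q \<le> N div L" using L by (simp add: less_eq_div_iff_mult_less_eq mult.commute)
    then show "L * (k div L) = k" "k div L \<in> {1..N div L}"
      "(?m * ?m') powr \<sigma> * real (L * (k div L)) powr (- 2 * \<sigma>) = (?m * ?m') powr \<sigma> * real k powr (- 2 * \<sigma>)"
      using q L by (auto simp: Suc_le_eq)
  next
    fix q assume "q \<in> {1..N div L}"
    then show "L * q div L = q" "L * q \<in> {k \<in> {1..N}. L dvd k}"
      using L by (auto simp: less_eq_div_iff_mult_less_eq mult.commute Suc_le_eq)
  qed
  also have "\<dots> = (?m * ?m') powr \<sigma> * real L powr (- 2 * \<sigma>) * power_sum (1 - 2 * \<sigma>) (N div L)"
    by (simp add: power_sum_def sum_distrib_left powr_mult mult.assoc)
  finally show ?thesis unfolding L_def .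
qed

text \<open>The normalisation is explained by \<open>L\<^bsup>-2\<sigma>\<^esup> = L\<^sup>\<rho> / L\<close>: the factor \<open>1 / L\<close> completes the entry of \<open>E(\<sigma>,1)\<close>,
and \<open>L\<^sup>\<rho>\<close> together with \<open>N\<^bsup>-\<rho>\<^esup>\<close> makes the power sum scale invariant.\<close>
lemma gram_kernel_eq:
  assumes \<rho>: "\<rho> = 1 - 2 * \<sigma>" and N: "1 \<le> N"
  shows "\<rho> * real N powr (- \<rho>) * (\<Sum>k<N. T_entry \<sigma> k i * T_entry \<sigma> k j) = gram_kernel \<sigma> N i j"
proof -
  define L where "L = real (lcm (Suc i) (Suc j))"
  have "0 < lcm (Suc i) (Suc j)" by (rule lcm_pos_nat) auto
  then have L: "0 < L" unfolding L_def by (simp only: of_nat_0_less_iff)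
  have e: "L powr (- 2 * \<sigma>) = L powr \<rho> / L"
    using L by (simp add: \<rho> powr_diff powr_minus field_simps)
  have r: "(L / real N) powr \<rho> = L powr \<rho> * real N powr (- \<rho>)"
    using L N by (simp add: powr_divide powr_minus field_simps)
  show ?thesis
    unfolding gram_sum gram_kernel_def sampling_ratio_def E_kernel_def E_entry_def \<rho>[symmetric]
      L_def[symmetric] e r
    by (simp add: powr_mult)
qed

lemma gram_kernel_sym: "gram_kernel \<sigma> N i j = gram_kernel \<sigma> N j i"
  by (simp add: gram_kernel_def E_kernel_sym[of _ i j] lcm.commute)

lemma gram_kernel_outside:
  assumes "N \<le> i \<or> N \<le> j"
  shows "gram_kernel \<sigma> N i j = 0"
proof -
  have "0 < lcm (Suc i) (Suc j)" by (rule lcm_pos_nat) auto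
  then have "Suc i \<le> lcm (Suc i) (Suc j)" "Suc j \<le> lcm (Suc i) (Suc j)"
    by (auto intro: dvd_imp_le)
  then have "N < lcm (Suc i) (Suc j)" using assms by linarith
  then show ?thesis by (simp add: gram_kernel_def sampling_ratio_eq_0)
qed

lemma gram_form_eq:
  assumes "\<rho> = 1 - 2 * \<sigma>" "1 \<le> N"
  shows "(\<Sum>i<n. \<Sum>j<n. gram_kernel \<sigma> N i j * x j * x i)
     = \<rho> * real N powr (- \<rho>) * (\<Sum>k<N. (\<Sum>i<n. T_entry \<sigma> k i * x i)\<^sup>2)"
proof -
  let ?c = "\<rho> * real N powr (- \<rho>)"
  have "(\<Sum>i<n. \<Sum>j<n. gram_kernel \<sigma> N i j * x j * x i)
      = (\<Sum>i<n. \<Sum>j<n. \<Sum>k<N. ?c * ((T_entry \<sigma> k i * x i) * (T_entry \<sigma> k j * x j)))"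
    unfolding gram_kernel_eq[OF assms, symmetric] sum_distrib_left sum_distrib_right
    by (intro sum.cong refl) (simp only: mult_ac)
  also have "\<dots> = (\<Sum>i<n. \<Sum>k<N. \<Sum>j<n. ?c * ((T_entry \<sigma> k i * x i) * (T_entry \<sigma> k j * x j)))"
    by (intro sum.cong refl sum.swap)
  also have "\<dots> = (\<Sum>k<N. \<Sum>i<n. \<Sum>j<n. ?c * ((T_entry \<sigma> k i * x i) * (T_entry \<sigma> k j * x j)))"
    by (rule sum.swap)
  also have "\<dots> = ?c * (\<Sum>k<N. (\<Sum>i<n. T_entry \<sigma> k i * x i)\<^sup>2)"
    unfolding power2_eq_square sum_product by (simp only: sum_distrib_left)
  finally show ?thesis .
qed

lemma gram_kernel_bounded: "\<exists>H. kernel_bound (gram_kernel \<sigma> N) H"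
  using kernel_bound_finite[of N "gram_kernel \<sigma> N"] gram_kernel_outside by blast

theorem gram_kernel_compact_psd:
  assumes \<sigma>: "\<sigma> < 1/2" and N: "1 \<le> N"
  shows "compact_psd (kernel_op (gram_kernel \<sigma> N))"
proof -
  obtain H where H: "kernel_bound (gram_kernel \<sigma> N) H" using gram_kernel_bounded by blast
  show ?thesis
  proof (rule kernel_compact_psd[OF H gram_kernel_sym])
    show "0 \<le> (\<Sum>i<n. \<Sum>j<n. gram_kernel \<sigma> N i j * x j * x i)" for n x
      unfolding gram_form_eq[OF refl N] using \<sigma> by (intro mult_nonneg_nonneg sum_nonneg) auto
    have "(\<lambda>i j. if i < N \<and> j < N then 0 else gram_kernel \<sigma> N i j) = (\<lambda>i j. 0)"
      by (auto simp: fun_eq_iff gram_kernel_outside not_less)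
    moreover have "kernel_bound (\<lambda>i j. 0) e" if "0 < e" for e
      using that by (simp add: kernel_bound_def)
    ultimately show "\<exists>K. kernel_bound (\<lambda>i j. if i < K \<and> j < K then 0 else gram_kernel \<sigma> N i j) e" if "0 < e" for e
      using that by (intro exI[of _ N]) simp
  qed
qed

text \<open>Inside a large block the finitely many entries converge; outside it both kernels are dominated by
a multiple of \<open>E\<close>, whose tails are small in norm.\<close>
theorem gram_kernel_converges:
  assumes \<sigma>: "\<sigma> < 1/2" and \<delta>: "0 < \<delta>"
  shows "\<forall>\<^sub>F N in sequentially. kernel_bound (\<lambda>i j. gram_kernel \<sigma> N i j - E_kernel \<sigma> i j) \<delta>"
proof -
  have \<rho>: "0 < 1 - 2 * \<sigma>" using \<sigma> by simp
  obtain C where C: "0 \<le> C" "\<And>N L. sampling_ratio (1 - 2 * \<sigma>) N L \<le> C"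
    using sampling_ratio_le[OF \<rho>] by blast
  define e where "e = \<delta> / (2 * (C + 1))"
  have e: "0 < e" "(C + 1) * e = \<delta> / 2" using \<delta> C(1) by (auto simp: e_def field_simps)
  obtain K where K: "kernel_bound (\<lambda>i j. if i < K \<and> j < K then 0 else E_kernel \<sigma> i j) e"
    using E_kernel_small_tails[OF \<sigma> e(1)] by blast
  define b where "b N i j = (if i < K \<and> j < K then gram_kernel \<sigma> N i j - E_kernel \<sigma> i j else 0)" for N i j
  have "(\<lambda>N. \<bar>b N i j\<bar>) \<longlonglongrightarrow> 0" for i j
  proof -
    have "0 < lcm (Suc i) (Suc j)" by (rule lcm_pos_nat) auto
    then have "(\<lambda>N. E_kernel \<sigma> i j * sampling_ratio (1 - 2 * \<sigma>) N (lcm (Suc i) (Suc j)) - E_kernel \<sigma> i j)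
        \<longlonglongrightarrow> E_kernel \<sigma> i j * 1 - E_kernel \<sigma> i j"
      by (intro tendsto_intros sampling_ratio_tendsto[OF \<rho>])
    then have "(\<lambda>N. \<bar>gram_kernel \<sigma> N i j - E_kernel \<sigma> i j\<bar>) \<longlonglongrightarrow> 0"
      by (simp add: gram_kernel_def tendsto_rabs_zero)
    then show ?thesis by (cases "i < K \<and> j < K") (auto simp: b_def)
  qed
  then have "(\<lambda>N. \<Sum>i<K. \<Sum>j<K. \<bar>b N i j\<bar>) \<longlonglongrightarrow> (\<Sum>i<K. \<Sum>j<K. 0)"
    by (intro tendsto_sum)
  then have "\<forall>\<^sub>F N in sequentially. (\<Sum>i<K. \<Sum>j<K. \<bar>b N i j\<bar>) < \<delta> / 2"
    using \<delta> by (intro order_tendstoD) auto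
  then show ?thesis
  proof eventually_elim
    case (elim N)
    have "kernel_bound (b N) (\<Sum>i<K. \<Sum>j<K. \<bar>b N i j\<bar>)"
      by (rule kernel_bound_finite) (auto simp: b_def)
    then have b: "kernel_bound (b N) (\<delta> / 2)"
      by (rule kernel_bound_weaken) (use elim in simp)
    have far: "kernel_bound (\<lambda>i j. if i < K \<and> j < K then 0 else gram_kernel \<sigma> N i j - E_kernel \<sigma> i j) ((C + 1) * e)"
    proof (rule kernel_bound_mono[OF K])
      fix i j
      have "\<bar>gram_kernel \<sigma> N i j - E_kernel \<sigma> i j\<bar> \<le> gram_kernel \<sigma> N i j + E_kernel \<sigma> i j"
        using E_kernel_nonneg[of \<sigma> i j] sampling_ratio_nonneg[OF \<rho>, of N "lcm (Suc i) (Suc j)"]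
        by (simp add: gram_kernel_def abs_le_iff)
      also have "\<dots> \<le> E_kernel \<sigma> i j * C + E_kernel \<sigma> i j"
        unfolding gram_kernel_def by (intro add_mono mult_left_mono C E_kernel_nonneg) simp
      finally show "\<bar>if i < K \<and> j < K then 0 else gram_kernel \<sigma> N i j - E_kernel \<sigma> i j\<bar>
          \<le> (C + 1) * \<bar>if i < K \<and> j < K then 0 else E_kernel \<sigma> i j\<bar>"
        using E_kernel_nonneg[of \<sigma> i j] by (simp add: algebra_simps)
    qed (use C in simp)
    have "kernel_bound (\<lambda>i j. gram_kernel \<sigma> N i j - E_kernel \<sigma> i j) (\<delta> / 2 + (C + 1) * e)"
      by (rule kernel_bound_add[OF b far]) (simp add: b_def)
    then show ?case using e(2) by simp
  qed
qed

section \<open>The eigenvalue listing of the limit operator\<close>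

text \<open>If \<open>l' k < l k\<close>, then \<open>l'\<close> can take the value \<open>l k\<close> only before \<open>k\<close>, where it agrees with \<open>l\<close>. It then takes
this value less often than \<open>l\<close> does.\<close>
lemma decseq_agree_step:
  fixes l l' :: "nat \<Rightarrow> real"
  assumes dec: "decseq l'" and fin: "finite {i. l i = l k}"
    and card: "card {i. l i = l k} = card {i. l' i = l k}"
    and below: "\<And>i. i < k \<Longrightarrow> l i = l' i"
  shows "l k \<le> l' k"
proof (rule ccontr)
  assume "\<not> l k \<le> l' k"
  then have less: "l' k < l k" by simp
  have "{i. l' i = l k} \<subseteq> {i. i < k \<and> l i = l k}"
  proof
    fix i assume i: "i \<in> {i. l' i = l k}"
    have "i < k"
    proof (rule ccontr)
      assume "\<not> i < k"
      then have "l' i \<le> l' k" by (intro decseqD[OF dec]) simp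
      then show False using i less by simp
    qed
    then show "i \<in> {i. i < k \<and> l i = l k}" using i below by simp
  qed
  then have "card {i. l' i = l k} \<le> card {i. i < k \<and> l i = l k}" by (intro card_mono) auto
  also have "\<dots> < card {i. l i = l k}"
    by (rule psubset_card_mono[OF fin]) auto
  finally show False using card by simp
qed

lemma decseq_eq_if_same_multiplicities:
  fixes l l' :: "nat \<Rightarrow> real"
  assumes "decseq l" "decseq l'" and fin: "\<And>\<mu>. finite {i. l i = \<mu>}" "\<And>\<mu>. finite {i. l' i = \<mu>}"
    and card: "\<And>\<mu>. card {i. l i = \<mu>} = card {i. l' i = \<mu>}"
  shows "l = l'"
proof
  fix k
  show "l k = l' k"
  proof (induction k rule: less_induct)
    case (less k)
    have "l k \<le> l' k" using decseq_agree_step[of l' l k] assms less by simp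
    moreover have "l' k \<le> l k" using decseq_agree_step[of l l' k] assms less by simp
    ultimately show ?case by simp
  qed
qed

text \<open>Two bases of a finite-dimensional eigenspace are equinumerous, so two listings contain every number
equally often.\<close>
lemma lists_eigenvalues_unique:
  assumes l: "lists_eigenvalues A l" and l': "lists_eigenvalues A l'"
    and fin: "\<And>\<mu>. finite {k. l k = \<mu>}"
  shows "l = l'"
proof -
  have *: "finite {k. l' k = \<mu>} \<and> card {k. l k = \<mu>} = card {k. l' k = \<mu>}" for \<mu>
  proof -
    obtain B f where B: "cseq.independent B" "cseq.span B = ell2_eigenspace A \<mu>" "bij_betw f {k. l k = \<mu>} B"
      using l unfolding lists_eigenvalues_def by blast
    obtain B' f' where B': "cseq.independent B'" "cseq.span B' = ell2_eigenspace A \<mu>" "bij_betw f' {k. l' k = \<mu>} B'"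
      using l' unfolding lists_eigenvalues_def by blast
    have finB: "finite B" using B(3) fin bij_betw_finite by blast
    have 1: "finite B' \<and> card B' \<le> card B"
      using cseq.span_superset[of B'] B B' by (intro cseq.independent_span_bound[OF finB]) auto
    have "card B \<le> card B'"
      using cseq.independent_span_bound[of B' B] cseq.span_superset[of B] 1 B B' by auto
    then show ?thesis using 1 B(3) B'(3) bij_betw_finite bij_betw_same_card by (metis antisym)
  qed
  show ?thesis
    using l l' fin * by (intro decseq_eq_if_same_multiplicities) (auto simp: lists_eigenvalues_def)
qed

definition complexify :: "l2 \<Rightarrow> l2 \<Rightarrow> nat \<Rightarrow> complex" where
  "complexify a b i = Complex (coord a i) (coord b i)"

lemma complexify_eq_iff [simp]: "complexify a b = complexify a' b' \<longleftrightarrow> a = a' \<and> b = b'"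
  by (auto simp: fun_eq_iff complexify_def intro: l2_eqI)

lemma ell2_iff_complexify: "x \<in> ell2 \<longleftrightarrow> (\<exists>a b. x = complexify a b)"
proof
  assume "x \<in> ell2"
  then have s: "summable (\<lambda>i. (cmod (x i))\<^sup>2)" by (simp add: ell2_def)
  have re: "summable (\<lambda>i. (Re (x i))\<^sup>2)"
    by (rule summable_comparison_test'[OF s, where N = 0]) (simp add: cmod_power2)
  have im: "summable (\<lambda>i. (Im (x i))\<^sup>2)"
    by (rule summable_comparison_test'[OF s, where N = 0]) (simp add: cmod_power2)
  have "x = complexify (Abs_l2 (\<lambda>i. Re (x i))) (Abs_l2 (\<lambda>i. Im (x i)))"
    by (simp add: fun_eq_iff complexify_def coord_Abs[OF re] coord_Abs[OF im])
  then show "\<exists>a b. x = complexify a b" by blast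
next
  assume "\<exists>a b. x = complexify a b"
  then show "x \<in> ell2"
    by (auto simp: ell2_def complexify_def cmod_power2 intro!: summable_add summable_coord)
qed

lemma complexify_zero [simp]: "complexify 0 0 = 0"
  by (simp add: fun_eq_iff complexify_def complex_eq_iff)

lemma complexify_eq_0_iff: "complexify a b = 0 \<longleftrightarrow> a = 0 \<and> b = 0"
  using complexify_eq_iff[of a b 0 0] unfolding complexify_zero .

lemma scale_complexify: "(\<lambda>i. of_real \<mu> * complexify a b i) = complexify (\<mu> *\<^sub>R a) (\<mu> *\<^sub>R b)"
  by (simp add: fun_eq_iff complexify_def complex_eq_iff)

lemma sum_fun_apply: "(\<Sum>k\<in>S. f k) i = (\<Sum>k\<in>S. f k i)"
  by (induction S rule: infinite_finite_induct) auto

lemma complex_combination: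
  "(\<Sum>k\<in>S. (\<lambda>i. c k * complexify (u k) 0 i))
     = complexify (\<Sum>k\<in>S. Re (c k) *\<^sub>R u k) (\<Sum>k\<in>S. Im (c k) *\<^sub>R u k)"
  by (simp add: fun_eq_iff sum_fun_apply complexify_def complex_eq_iff)

lemma E_op_complexify:
  assumes "\<sigma> < 1/2"
  shows "E_op \<sigma> (complexify a b) = complexify (kernel_op (E_kernel \<sigma>) a) (kernel_op (E_kernel \<sigma>) b)"
proof
  fix i
  obtain H where H: "kernel_bound (E_kernel \<sigma>) H" using E_kernel_bounded[OF assms] by blast
  have "(\<lambda>j. E_kernel \<sigma> i j * coord x j) sums coord (kernel_op (E_kernel \<sigma>) x) i" for x
    using inner_l2_sums[of "kernel_row (E_kernel \<sigma>) i" x]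
    by (simp add: coord_kernel_row[OF H] coord_kernel_op[OF H])
  then have "(\<lambda>j. of_real (E_entry \<sigma> (Suc i) (Suc j)) * complexify a b j)
      sums complexify (kernel_op (E_kernel \<sigma>) a) (kernel_op (E_kernel \<sigma>) b) i"
    by (simp add: sums_complex_iff complexify_def E_kernel_def[symmetric])
  then show "E_op \<sigma> (complexify a b) i = complexify (kernel_op (E_kernel \<sigma>) a) (kernel_op (E_kernel \<sigma>) b) i"
    unfolding E_op_def by (rule sums_unique[symmetric])
qed

lemma eigenspace_complexify:
  assumes "\<sigma> < 1/2"
  shows "ell2_eigenspace (E_op \<sigma>) \<mu> = {complexify a b | a b.
      kernel_op (E_kernel \<sigma>) a = \<mu> *\<^sub>R a \<and> kernel_op (E_kernel \<sigma>) b = \<mu> *\<^sub>R b}"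
  unfolding ell2_eigenspace_def ell2_iff_complexify
  by (auto simp: E_op_complexify[OF assms] scale_complexify)

text \<open>Real vectors that are orthonormal stay linearly independent over the complex numbers, and their
complex span is the complexification of the real one: separate real and imaginary parts.\<close>
lemma complexified_basis:
  assumes u: "orthonormal_seq u" and S: "finite S"
  defines "B \<equiv> (\<lambda>k. complexify (u k) 0) ` S"
  shows "bij_betw (\<lambda>k. complexify (u k) 0) S B"
    and "cseq.independent B"
    and "cseq.span B = {complexify (\<Sum>k\<in>S. a k *\<^sub>R u k) (\<Sum>k\<in>S. b k *\<^sub>R u k) | a b. True}"
proof -
  let ?f = "\<lambda>k. complexify (u k) 0"
  have inj: "inj_on ?f S"
  proof (rule inj_onI)
    fix i j assume "?f i = ?f j"
    then have "u i \<bullet> u i = u i \<bullet> u j" by simp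
    then show "i = j" by (auto simp: orthonormal_seqD[OF u] split: if_splits)
  qed
  show "bij_betw ?f S B" using inj by (simp add: B_def bij_betw_def)
  have finB: "finite B" using S by (simp add: B_def)
  have sumB: "(\<Sum>v\<in>B. (\<lambda>i. c v * v i))
      = complexify (\<Sum>k\<in>S. Re (c (?f k)) *\<^sub>R u k) (\<Sum>k\<in>S. Im (c (?f k)) *\<^sub>R u k)" for c
    unfolding B_def sum.reindex[OF inj] o_def by (rule complex_combination)
  show "cseq.independent B"
  proof (rule cseq.independent_if_scalars_zero[OF finB])
    fix c v assume "(\<Sum>v\<in>B. (\<lambda>i. c v * v i)) = 0" and v: "v \<in> B"
    then have z: "(\<Sum>k\<in>S. Re (c (?f k)) *\<^sub>R u k) = 0" "(\<Sum>k\<in>S. Im (c (?f k)) *\<^sub>R u k) = 0"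
      unfolding sumB complexify_eq_0_iff by auto
    obtain m where m: "m \<in> S" "v = ?f m" using v by (auto simp: B_def)
    have "Re (c (?f m)) = 0" "Im (c (?f m)) = 0"
      using orthonormal_inner_sum[OF u S, of "\<lambda>k. Re (c (?f k))" m]
        orthonormal_inner_sum[OF u S, of "\<lambda>k. Im (c (?f k))" m] m(1) z by auto
    then show "c v = 0" by (simp add: m complex_eq_iff)
  qed
  show "cseq.span B = {complexify (\<Sum>k\<in>S. a k *\<^sub>R u k) (\<Sum>k\<in>S. b k *\<^sub>R u k) | a b. True}"
    unfolding cseq.span_finite[OF finB]
  proof (intro equalityI subsetI)
    fix x assume "x \<in> range (\<lambda>c. \<Sum>v\<in>B. (\<lambda>i. c v * v i))"
    then show "x \<in> {complexify (\<Sum>k\<in>S. a k *\<^sub>R u k) (\<Sum>k\<in>S. b k *\<^sub>R u k) | a b. True}"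
      unfolding sumB by auto
  next
    fix x assume "x \<in> {complexify (\<Sum>k\<in>S. a k *\<^sub>R u k) (\<Sum>k\<in>S. b k *\<^sub>R u k) | a b. True}"
    then obtain a b where x: "x = complexify (\<Sum>k\<in>S. a k *\<^sub>R u k) (\<Sum>k\<in>S. b k *\<^sub>R u k)" by blast
    define c where "c v = (let k = inv_into S ?f v in Complex (a k) (b k))" for v
    have "(\<Sum>k\<in>S. Re (c (?f k)) *\<^sub>R u k) = (\<Sum>k\<in>S. a k *\<^sub>R u k)"
      "(\<Sum>k\<in>S. Im (c (?f k)) *\<^sub>R u k) = (\<Sum>k\<in>S. b k *\<^sub>R u k)"
      by (auto intro!: sum.cong simp: c_def inv_into_f_f[OF inj])
    then have "x = (\<Sum>v\<in>B. (\<lambda>i. c v * v i))" unfolding x sumB by simp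
    then show "x \<in> range (\<lambda>c. \<Sum>v\<in>B. (\<lambda>i. c v * v i))" by blast
  qed
qed

theorem nth_eigenvalue_E_op:
  assumes \<sigma>: "\<sigma> < 1/2" and basis: "eigenbasis (kernel_op (E_kernel \<sigma>)) u l"
  shows "nth_eigenvalue (E_op \<sigma>) n = l (n - 1)"
proof -
  let ?A = "kernel_op (E_kernel \<sigma>)"
  interpret compact_psd ?A by (rule E_kernel_compact_psd[OF \<sigma>])
  note u = orthonormal[OF basis] and Au = eigenvector[OF basis]
  have l_neq: "l k \<noteq> 0" for k
  proof
    assume "l k = 0"
    then have "?A (u k) = 0" using Au by simp
    then have "u k = 0" by (rule E_kernel_injective[OF \<sigma>])
    then show False using orthonormal_seqD[OF u, of k k] by simp
  qed
  have fin: "finite {k. l k = \<mu>}" for \<mu>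
  proof (cases "\<mu> = 0")
    case True
    then show ?thesis using l_neq by simp
  qed (rule finite_multiplicity[OF basis])
  have espace: "{complexify a b | a b. ?A a = \<mu> *\<^sub>R a \<and> ?A b = \<mu> *\<^sub>R b}
      = {complexify (\<Sum>k | l k = \<mu>. a k *\<^sub>R u k) (\<Sum>k | l k = \<mu>. b k *\<^sub>R u k) | a b. True}" for \<mu>
  proof -
    have "?A x = \<mu> *\<^sub>R x \<longleftrightarrow> (\<exists>a. x = (\<Sum>k | l k = \<mu>. a k *\<^sub>R u k))" for x
    proof
      assume x: "?A x = \<mu> *\<^sub>R x"
      show "\<exists>a. x = (\<Sum>k | l k = \<mu>. a k *\<^sub>R u k)"
      proof (cases "\<mu> = 0")
        case True
        then have "x = 0" using x E_kernel_injective[OF \<sigma>] by simp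
        then show ?thesis using True l_neq by simp
      next
        case False
        show ?thesis by (intro exI[of _ "\<lambda>k. x \<bullet> u k"] eigenvector_expansion[OF basis False x])
      qed
    next
      assume "\<exists>a. x = (\<Sum>k | l k = \<mu>. a k *\<^sub>R u k)"
      then obtain a where a: "x = (\<Sum>k | l k = \<mu>. a k *\<^sub>R u k)" by blast
      show "?A x = \<mu> *\<^sub>R x"
        unfolding a linear_sum[OF linear] linear_scale[OF linear] scaleR_sum_right
        by (intro sum.cong) (auto simp: Au)
    qed
    note iff = this
    show ?thesis unfolding iff by (rule Collect_cong) auto
  qed
  have lists: "lists_eigenvalues (E_op \<sigma>) l"
    unfolding lists_eigenvalues_def
  proof (intro conjI allI)
    show "decseq l" by (rule decseq[OF basis])
    fix \<mu>
    show "\<exists>B f. cseq.independent B \<and> cseq.span B = ell2_eigenspace (E_op \<sigma>) \<mu> \<and> bij_betw f {k. l k = \<mu>} B"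
      using complexified_basis[OF u fin[of \<mu>]] unfolding eigenspace_complexify[OF \<sigma>] espace by blast
  qed
  have "(THE l. lists_eigenvalues (E_op \<sigma>) l) = l"
  proof (rule the_equality)
    show "l' = l" if "lists_eigenvalues (E_op \<sigma>) l'" for l'
      by (rule lists_eigenvalues_unique[OF lists that fin, symmetric])
  qed (rule lists)
  then show ?thesis by (simp add: nth_eigenvalue_def)
qed

section \<open>Singular values of the truncated matrices\<close>

text \<open>The form is a positive multiple of \<open>\<parallel>T x\<parallel>\<^sup>2\<close>. As \<open>T\<close> is lower triangular with unit diagonal, the coordinate
of \<open>T x\<close> at the first nonzero coordinate \<open>p\<close> of \<open>x\<close> equals \<open>x p\<close>.\<close>
lemma gram_form_positive:
  assumes \<sigma>: "\<sigma> < 1/2" and k: "k < N" and c: "\<exists>i\<le>k. c i \<noteq> 0"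
  defines "x \<equiv> \<Sum>i\<le>k. c i *\<^sub>R unit_l2 i"
  shows "0 < kernel_op (gram_kernel \<sigma> N) x \<bullet> x"
proof -
  have N: "1 \<le> N" using k by simp
  obtain H where H: "kernel_bound (gram_kernel \<sigma> N) H" using gram_kernel_bounded by blast
  have "kernel_bound (\<lambda>i j. if i < N \<and> j < N then 0 else gram_kernel \<sigma> N i j) 0"
    by (auto simp: kernel_bound_def gram_kernel_outside not_less intro!: sum_nonpos)
  from kernel_form_tail_le[OF H this, of x]
  have "kernel_op (gram_kernel \<sigma> N) x \<bullet> x = (\<Sum>i<N. \<Sum>j<N. gram_kernel \<sigma> N i j * coord x j * coord x i)"
    by simp
  also have "\<dots> = (1 - 2 * \<sigma>) * real N powr (- (1 - 2 * \<sigma>)) * (\<Sum>k<N. (\<Sum>i<N. T_entry \<sigma> k i * coord x i)\<^sup>2)"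
    by (rule gram_form_eq[OF refl N])
  finally have form: "kernel_op (gram_kernel \<sigma> N) x \<bullet> x = \<dots>" .
  have cx: "coord x i = (if i \<le> k then c i else 0)" for i
  proof -
    have "coord x i = (\<Sum>m\<le>k. if i = m then c m else 0)"
      unfolding x_def coord_sum by (intro sum.cong) auto
    then show ?thesis by simp
  qed
  obtain p where p: "c p \<noteq> 0" "p \<le> k" and least: "\<And>i. i < p \<Longrightarrow> c i = 0"
  proof -
    define p where "p = (LEAST i. i \<le> k \<and> c i \<noteq> 0)"
    have "p \<le> k \<and> c p \<noteq> 0" unfolding p_def using c by (rule LeastI_ex[of "\<lambda>i. i \<le> k \<and> c i \<noteq> 0"])
    moreover have "c i = 0" if "i < p" for i
      using not_less_Least[of i "\<lambda>i. i \<le> k \<and> c i \<noteq> 0"] that calculation unfolding p_def[symmetric] by auto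
    ultimately show ?thesis using that by blast
  qed
  have pN: "p < N" using p k by simp
  have "(\<Sum>i<N. T_entry \<sigma> p i * coord x i) = (\<Sum>i\<in>{p}. T_entry \<sigma> p i * coord x i)"
  proof (rule sum.mono_neutral_right)
    show "\<forall>i\<in>{..<N} - {p}. T_entry \<sigma> p i * coord x i = 0"
    proof
      fix i assume "i \<in> {..<N} - {p}"
      then consider "i < p" | "p < i" by fastforce
      then show "T_entry \<sigma> p i * coord x i = 0"
      proof cases
        case 1
        then show ?thesis using least by (simp add: cx)
      next
        case 2
        then have "\<not> Suc i dvd Suc p" by (auto dest: dvd_imp_le)
        then show ?thesis by (simp add: T_entry_def)
      qed
    qed
  qed (use pN in auto)
  also have "\<dots> = c p" using p by (simp add: T_entry_def cx)
  finally have "0 < (\<Sum>i<N. T_entry \<sigma> p i * coord x i)\<^sup>2" using p by simp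
  then have "0 < (\<Sum>k<N. (\<Sum>i<N. T_entry \<sigma> k i * coord x i)\<^sup>2)"
    using pN by (intro sum_pos2[of _ p]) auto
  then show ?thesis unfolding form using \<sigma> N by (intro mult_pos_pos) auto
qed

text \<open>The form is positive definite on the span of the first \<open>N\<close> unit vectors, so \<open>N\<close> eigenvalues are
positive. An eigenvector to a nonzero eigenvalue lies in the range of the operator, hence in the first \<open>N\<close>
coordinates.\<close>
lemma gram_eigenvectors_supported:
  assumes \<sigma>: "\<sigma> < 1/2" and basis: "eigenbasis (kernel_op (gram_kernel \<sigma> N)) v m" and k: "k < N"
  shows "0 < m k" and "N \<le> i \<Longrightarrow> coord (v k) i = 0"
proof -
  show pos: "0 < m k"
    by (rule eigenvalue_positive[OF basis gram_form_positive[OF \<sigma> k]])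
  obtain H where H: "kernel_bound (gram_kernel \<sigma> N) H" using gram_kernel_bounded by blast
  assume i: "N \<le> i"
  have "kernel_row (gram_kernel \<sigma> N) i = 0"
    by (rule l2_eqI) (use i in \<open>simp add: coord_kernel_row[OF H] gram_kernel_outside\<close>)
  then have "coord (kernel_op (gram_kernel \<sigma> N) (v k)) i = 0" by (simp add: coord_kernel_op[OF H])
  then have "m k * coord (v k) i = 0" using basis by (simp add: eigenbasis_def)
  then show "coord (v k) i = 0" using pos by simp
qed

lemma sum_eq_l2_inner:
  assumes "\<And>i. N \<le> i \<Longrightarrow> coord y i = 0"
  shows "(\<Sum>i<N. coord x i * coord y i) = x \<bullet> y"
proof -
  have "(\<lambda>i. coord x i * coord y i) sums (\<Sum>i<N. coord x i * coord y i)"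
    using assms by (intro sums_finite) auto
  from sums_unique2[OF this inner_l2_sums] show ?thesis .
qed

lemma char_poly_orthogonal_diagonalization:
  fixes G P :: "real mat"
  assumes G: "G \<in> carrier_mat N N" and P: "P \<in> carrier_mat N N"
    and orth: "P\<^sup>T * P = 1\<^sub>m N"
    and GP: "G * P = P * mat N N (\<lambda>(i, j). if i = j then d i else 0)"
  shows "char_poly G = (\<Prod>k\<leftarrow>[0..<N]. [:- d k, 1:])"
proof -
  let ?D = "mat N N (\<lambda>(i, j). if i = j then d i else 0)"
  have PT: "P\<^sup>T \<in> carrier_mat N N" using P by simp
  have PPT: "P * P\<^sup>T = 1\<^sub>m N" by (rule mat_mult_left_right_inverse[OF PT P orth])
  have "G = G * (P * P\<^sup>T)" using G by (simp add: PPT)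
  also have "\<dots> = G * P * P\<^sup>T" by (rule assoc_mult_mat[OF G P PT, symmetric])
  also have "\<dots> = P * ?D * P\<^sup>T" by (simp only: GP)
  finally have "G = P * ?D * P\<^sup>T" .
  then have "similar_mat_wit G ?D P P\<^sup>T"
    by (intro similar_mat_witI[OF PPT orth _ G _ P PT]) auto
  then have "similar_mat G ?D" unfolding similar_mat_def by blast
  then have "char_poly G = char_poly ?D" by (rule char_poly_similar)
  also have "\<dots> = (\<Prod>a\<leftarrow>diag_mat ?D. [:- a, 1:])"
    by (rule char_poly_upper_triangular[of _ N]) auto
  also have "diag_mat ?D = map d [0..<N]" by (simp add: diag_mat_def)
  finally show ?thesis by (simp add: o_def)
qed

lemma singular_values_of_diagonalized_gram:
  fixes A P :: "real mat"
  assumes A: "A \<in> carrier_mat M N" and P: "P \<in> carrier_mat N N"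
    and orth: "P\<^sup>T * P = 1\<^sub>m N"
    and GP: "(A\<^sup>T * A) * P = P * mat N N (\<lambda>(i, j). if i = j then d i else 0)"
    and dec: "\<And>i j. i \<le> j \<Longrightarrow> d j \<le> d i"
  shows "singular_values A = map (\<lambda>k. sqrt (d k)) [0..<N]"
proof -
  let ?ds = "map d [0..<N]"
  have "char_poly (A\<^sup>T * A) = (\<Prod>k\<leftarrow>[0..<N]. [:- d k, 1:])"
    using A by (intro char_poly_orthogonal_diagonalization[OF _ P orth GP]) auto
  moreover have "proots (\<Prod>k\<leftarrow>ks. [:- d k, 1:]) = mset (map d ks)" for ks :: "nat list"
  proof (induction ks)
    case (Cons k ks)
    have "(\<Prod>k\<leftarrow>ks. [:- d k, 1:]) \<noteq> 0" by (simp add: prod_list_zero_iff image_iff)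
    from proots_mult[OF _ this, of "[:- d k, 1:]"] have "proots ([:- d k, 1:] * (\<Prod>k\<leftarrow>ks. [:- d k, 1:]))
        = proots [:- d k, 1:] + proots (\<Prod>k\<leftarrow>ks. [:- d k, 1:])" by simp
    then show ?case using Cons by simp
  qed simp
  ultimately have "sorted_list_of_multiset (proots (char_poly (A\<^sup>T * A))) = sort ?ds"
    by (simp only: sorted_list_of_multiset_mset)
  also have "sort ?ds = rev ?ds"
  proof (rule properties_for_sort)
    show "sorted (rev ?ds)"
      by (auto simp: sorted_rev_iff_nth_mono intro!: dec)
  qed simp
  finally show ?thesis by (simp add: singular_values_def rev_map o_def)
qed

text \<open>The first \<open>N\<close> eigenvectors of the extended scaled Gram matrix form an orthogonal matrix that
diagonalises the Gram matrix, so the first \<open>N\<close> eigenvalues, scaled back, are all of its eigenvalues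
with their multiplicities.\<close>
theorem singular_value_T_psi:
  assumes \<sigma>: "\<sigma> < 1/2" and \<rho>: "\<rho> = 1 - 2 * \<sigma>" and n: "n \<in> {1..N}"
    and basis: "eigenbasis (kernel_op (gram_kernel \<sigma> N)) v m"
  shows "(singular_value (T_psi \<sigma> N) n)\<^sup>2 = 1 / \<rho> * real N powr \<rho> * m (n - 1)"
proof -
  let ?c = "1 / \<rho> * real N powr \<rho>"
  let ?T = "T_psi \<sigma> N" and ?P = "mat N N (\<lambda>(i, k). coord (v k) i)"
  have N: "1 \<le> N" and \<rho>0: "0 < \<rho>" using n \<sigma> \<rho> by auto
  have c: "0 < ?c" using N \<rho>0 by simp
  obtain H where H: "kernel_bound (gram_kernel \<sigma> N) H" using gram_kernel_bounded by blast
  have on: "orthonormal_seq v" and eig: "\<And>k. kernel_op (gram_kernel \<sigma> N) (v k) = m k *\<^sub>R v k" and dec: "decseq m"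
    using basis by (auto simp: eigenbasis_def)
  note supp = gram_eigenvectors_supported(2)[OF \<sigma> basis]
  have T: "?T \<in> carrier_mat N N" by (simp add: T_psi_def)
  have gram: "(?T\<^sup>T * ?T) $$ (i, j) = ?c * gram_kernel \<sigma> N i j" if "i < N" "j < N" for i j
  proof -
    have "(?T\<^sup>T * ?T) $$ (i, j) = (\<Sum>k<N. T_entry \<sigma> k i * T_entry \<sigma> k j)"
      using that by (simp add: T_psi_def T_entry_def scalar_prod_def lessThan_atLeast0)
    moreover have "?c * (\<rho> * real N powr (- \<rho>)) = 1"
      using N \<rho>0 by (simp add: powr_minus)
    ultimately show ?thesis
      unfolding gram_kernel_eq[OF \<rho> N, symmetric] by (metis mult.assoc mult_1)
  qed
  have "singular_values ?T = map (\<lambda>k. sqrt (?c * m k)) [0..<N]"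
  proof (rule singular_values_of_diagonalized_gram[OF T])
    show "?P \<in> carrier_mat N N" by simp
    show "?P\<^sup>T * ?P = 1\<^sub>m N"
    proof (rule eq_matI)
      fix i j assume "i < dim_row (1\<^sub>m N :: real mat)" "j < dim_col (1\<^sub>m N :: real mat)"
      then have ij: "i < N" "j < N" by auto
      then have "(?P\<^sup>T * ?P) $$ (i, j) = (\<Sum>k<N. coord (v i) k * coord (v j) k)"
        by (simp add: scalar_prod_def lessThan_atLeast0)
      also have "\<dots> = v i \<bullet> v j" by (rule sum_eq_l2_inner) (rule supp[OF ij(2)])
      finally show "(?P\<^sup>T * ?P) $$ (i, j) = 1\<^sub>m N $$ (i, j)"
        using ij by (simp add: orthonormal_seqD[OF on])
    qed auto
    show "(?T\<^sup>T * ?T) * ?P = ?P * mat N N (\<lambda>(i, j). if i = j then ?c * m i else 0)"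
    proof (rule eq_matI)
      fix i k assume "i < dim_row (?P * mat N N (\<lambda>(i, j). if i = j then ?c * m i else 0))"
        "k < dim_col (?P * mat N N (\<lambda>(i, j). if i = j then ?c * m i else 0))"
      then have ik: "i < N" "k < N" by auto
      have TT: "?T\<^sup>T * ?T \<in> carrier_mat N N" using T by simp
      then have "((?T\<^sup>T * ?T) * ?P) $$ (i, k) = (\<Sum>j<N. (?T\<^sup>T * ?T) $$ (i, j) * coord (v k) j)"
        using ik by (subst index_mult_mat) (auto simp: scalar_prod_def lessThan_atLeast0 row_def)
      also have "\<dots> = (\<Sum>j<N. ?c * (coord (kernel_row (gram_kernel \<sigma> N) i) j * coord (v k) j))"
        using ik by (intro sum.cong) (auto simp: gram coord_kernel_row[OF H])
      also have "\<dots> = ?c * (\<Sum>j<N. coord (kernel_row (gram_kernel \<sigma> N) i) j * coord (v k) j)"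
        by (rule sum_distrib_left[symmetric])
      also have "(\<Sum>j<N. coord (kernel_row (gram_kernel \<sigma> N) i) j * coord (v k) j) = kernel_row (gram_kernel \<sigma> N) i \<bullet> v k"
        by (rule sum_eq_l2_inner) (rule supp[OF ik(2)])
      also have "\<dots> = m k * coord (v k) i"
        using coord_kernel_op[OF H, of "v k" i] by (simp add: eig)
      finally have L: "((?T\<^sup>T * ?T) * ?P) $$ (i, k) = ?c * (m k * coord (v k) i)" .
      have "(?P * mat N N (\<lambda>(i, j). if i = j then ?c * m i else 0)) $$ (i, k)
          = (\<Sum>j<N. coord (v j) i * (if j = k then ?c * m j else 0))"
        using ik by (simp add: scalar_prod_def lessThan_atLeast0)
      also have "\<dots> = (\<Sum>j<N. if j = k then coord (v j) i * (?c * m j) else 0)"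
        by (intro sum.cong) auto
      also have "\<dots> = coord (v k) i * (?c * m k)" using ik by simp
      finally show "((?T\<^sup>T * ?T) * ?P) $$ (i, k)
          = (?P * mat N N (\<lambda>(i, j). if i = j then ?c * m i else 0)) $$ (i, k)"
        unfolding L by (simp only: mult_ac)
    qed (auto simp: T_psi_def)
    show "?c * m j \<le> ?c * m i" if "i \<le> j" for i j
      using c by (intro mult_left_mono decseqD[OF dec that]) auto
  qed
  moreover have "n - 1 < N" using n by auto
  ultimately have "singular_value ?T n = sqrt (?c * m (n - 1))"
    by (simp add: singular_value_def)
  moreover have "0 < m (n - 1)"
    using n by (intro gram_eigenvectors_supported(1)[OF \<sigma> basis]) auto
  then have "0 \<le> ?c * m (n - 1)" using c by (intro mult_nonneg_nonneg less_imp_le)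
  ultimately show ?thesis by (simp only: real_sqrt_pow2)
qed

theorem corollary2p2:
  fixes \<sigma> \<rho> :: real
  assumes "\<sigma> < 1/2" and "\<rho> = 1 - 2 * \<sigma>"
  shows "\<exists>\<epsilon> :: nat \<Rightarrow> nat \<Rightarrow> real.
           (\<forall>N\<ge>1. \<forall>n\<in>{1..N}.
              (singular_value (T_psi \<sigma> N) n)\<^sup>2
                = 1 / \<rho> * real N powr \<rho> * (nth_eigenvalue (E_op \<sigma>) n + \<epsilon> N n)) \<and>
           (\<forall>\<delta>>0. \<forall>\<^sub>F N in sequentially. \<forall>n\<in>{1..N}. \<bar>\<epsilon> N n\<bar> < \<delta>)"
proof -
  note \<sigma> = assms(1)
  obtain H where H: "kernel_bound (E_kernel \<sigma>) H" using E_kernel_bounded[OF \<sigma>] by blast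
  obtain u l where E: "eigenbasis (kernel_op (E_kernel \<sigma>)) u l"
    using compact_psd.eigenbasis_exists[OF E_kernel_compact_psd[OF \<sigma>]] by blast
  have "\<exists>vm. N \<ge> 1 \<longrightarrow> eigenbasis (kernel_op (gram_kernel \<sigma> N)) (fst vm) (snd vm)" for N
    using compact_psd.eigenbasis_exists[OF gram_kernel_compact_psd[OF \<sigma>, of N]] by auto
  then obtain vm where vm: "\<And>N. N \<ge> 1 \<Longrightarrow> eigenbasis (kernel_op (gram_kernel \<sigma> N)) (fst (vm N)) (snd (vm N))"
    by metis
  define m where "m N = snd (vm N)" for N
  define \<epsilon> where "\<epsilon> N n = m N (n - 1) - l (n - 1)" for N n
  show ?thesis
  proof (intro exI[of _ \<epsilon>] conjI allI impI ballI)
    fix N n :: nat assume "1 \<le> N" "n \<in> {1..N}"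
    then show "(singular_value (T_psi \<sigma> N) n)\<^sup>2
        = 1 / \<rho> * real N powr \<rho> * (nth_eigenvalue (E_op \<sigma>) n + \<epsilon> N n)"
      using singular_value_T_psi[OF \<sigma> assms(2) _ vm] nth_eigenvalue_E_op[OF \<sigma> E]
      by (simp add: \<epsilon>_def m_def)
  next
    fix \<delta> :: real assume \<delta>: "0 < \<delta>"
    then have "0 < \<delta> / 2" by simp
    from gram_kernel_converges[OF \<sigma> this] eventually_ge_at_top[of 1]
    show "\<forall>\<^sub>F N in sequentially. \<forall>n\<in>{1..N}. \<bar>\<epsilon> N n\<bar> < \<delta>"
    proof eventually_elim
      case (elim N)
      note G = vm[OF elim(2), folded m_def]
      obtain H' where H': "kernel_bound (gram_kernel \<sigma> N) H'" using gram_kernel_bounded by blast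
      note diff = kernel_form_diff_le[OF H' H elim(1)]
      have upper: "m N k \<le> l k + \<delta> / 2" for k
      proof (rule weyl_inequality[OF E G bounded_linear.linear[OF bounded_linear_kernel_op[OF H']]])
        show "kernel_op (gram_kernel \<sigma> N) x \<bullet> x \<le> kernel_op (E_kernel \<sigma>) x \<bullet> x + \<delta> / 2 * (norm x)\<^sup>2" for x
          using diff[of x] by linarith
      qed
      have lower: "l k \<le> m N k + \<delta> / 2" for k
      proof (rule weyl_inequality[OF G E bounded_linear.linear[OF bounded_linear_kernel_op[OF H]]])
        show "kernel_op (E_kernel \<sigma>) x \<bullet> x \<le> kernel_op (gram_kernel \<sigma> N) x \<bullet> x + \<delta> / 2 * (norm x)\<^sup>2" for x
          using diff[of x] by linarith
      qed
      have "\<bar>m N k - l k\<bar> < \<delta>" for k using upper[of k] lower[of k] \<delta> by linarith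
      then show ?case by (simp add: \<epsilon>_def)
    qed
  qed
qed

end
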